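(* Let $\mathcal{B}$ be a stable base. There is a valid $\mathcal{B}$-library $\rho$ and an algorithmic statement $Q_\rho$ such that $Q_\rho\vee\neg_\rho Q_\rho$ and $\neg_\rho Q_\rho\vee\neg_\rho\neg_\rho Q_\rho$ are both false. In particular, Rule $P_8$ (the rule implementing the premise-free diagram $\emptyset\,/\,A\vee\neg_\rho A$) and Rule $P_9$ (the rule implementing the premise-free diagram $\emptyset\,/\,\neg_\rho A\vee\neg_\rho\neg_\rho A$) are not $\rho$-valid. Therefore, there is no stable base containing Rule $P_8$ or Rule $P_9$.
   Context: Framework. Algorithms are recursive algorithms in a fixed standard model. A datum is anything that can be input to an algorithm; data include natural numbers and algorithms, and every finite list of data is a datum. Every algorithm accepts exactly one input datum and either does not halt or halts with exactly one output datum. Every datum has a positive integer size, only finitely many data have a given size, and the size of a list is strictly greater than the sum of the sizes of its items. A process is a pair (algorithm, input). Every halting process has a positive integer runtime; if a process runs subprocesses in its execution, its runtime is strictly greater than the sum of the runtimes of the halting subprocesses. An algorithmic statement is a datum $[\alpha,u,v]$ with $\alpha$ an algorithm, asserting that $\alpha$ with input $u$ halts with output $v$; it is true if this is so and false otherwise, and it is directly false if $\alpha$ halts on $u$ with an output different from $v$. $\mathcal{F}$ denotes the false statement $[\mathrm{identity},0,1]$, where $\mathrm{identity}$ outputs a copy of its input. Rules and libraries. An algorithmic sequence is an algorithm $\rho$ that halts on every positive integer $n$; its output is written $\rho_n$. A rule is an algorithm which, on every input $[H,\rho,m]$ with $H$ a finite list of algorithmic statements (hypothesis list), $\rho$ an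 algorithmic sequence (nominal library) and $m$ a positive integer (resource integer), halts and outputs a list of algorithmic statements (conclusion list) having $H$ as an initial sublist, and which is monotone: if $m'\ge m$ and every item of $H$ is an item of $H'$, then every item of the output on $[H,\rho,m]$ is an item of the output on $[H',\rho,m']$. A library is an algorithmic sequence $\rho$ such that every $\rho_n$ is a rule (not necessarily distinct); the $\rho_n$ are the rules contained in $\rho$. A rule is $\rho$-valid if for every list $H$ of true statements and every $m$, its output on $[H,\rho,m]$ consists only of true statements. A library $\rho$ is valid if all its rules are $\rho$-valid. Bases. A base is a set $\mathcal{B}$ of rules that is finite or is the set of terms of a library. A $\mathcal{B}$-library is a library containing all rules of $\mathcal{B}$. A $\mathcal{B}$-library $\rho$ is valid outside $\mathcal{B}$ if every rule in $\rho$ which is not in $\mathcal{B}$ is $\rho$-valid. A base $\mathcal{B}$ is stable if every $\mathcal{B}$-library that is valid outside $\mathcal{B}$ is valid. Deduction. Fix a recursive bijection $f:\mathbb{N}_+\to\mathbb{N}_+\times\mathbb{N}_+$. The algorithm $\mathrm{deduce}$, on input $[\Gamma,\rho,B]$ ($\Gamma$ a list of algorithmic statements, $\rho$ a library, $B$ an algorithmic statement), computes lists $H_0=\Gamma,H_1,H_2,\dots$, where for $i>0$ with $f(i)=(k,m)$ the list $H_i$ is the output of $\rho_k$ on $[H_{i-1},\rho,m]$; after computing each $H_i$ it checks whether $B$ is on $H_i$, outputs $1$ if so, and otherwise continues. The algorithmic statement $[\mathrm{deduce},[\Gamma,\rho,B],1]$ is denoted $\Gamma\vdash_\rho B$ (the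 notation is used for any datum $\rho$). $A\Rightarrow_\rho B$ denotes $[A]\vdash_\rho B$, and $\neg_\rho A$ denotes $A\Rightarrow_\rho\mathcal{F}$. Disjunction. The algorithm $\mathrm{or}$ on input $[A,B]$ (two algorithmic statements) outputs $1$ if $A$ or $B$ is true, $0$ if both are directly false, and otherwise does not halt; $A\vee B$ denotes the statement $[\mathrm{or},[A,B],1]$. The negation $\neg_\rho$ binds more tightly than $\vee$. Premise-free rules. A rule implementing "$\emptyset\,/\,Y$" requires no premises: on input $[H,\rho,m]$ it outputs $H$ with all instances of $Y$ (letters ranging over algorithmic statements) of size at most $m$ appended; the $\rho$ in $\neg_\rho$ is the nominal library in the input. *)

theory Defs
  imports Main "HOL-Library.Nat_Bijection"
begin

section \<open>Data and algorithms\<close>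

text \<open>The standard model of computation is a small programming language whose data are numbers,
  algorithms and finite lists of data. Primitives are total; on arguments of the wrong shape they
  return a default value.\<close>

datatype prim =
  Ident | Succ | Pred | Head | Tail | Equal | Leq | Kind | Size | Reflect | Reify

datatype datum = Num nat | Alg alg | Lst "datum list"
and alg =
    Prim prim
  | Const datum
  | Comp alg alg
  | Prepend alg alg
  | Cond alg alg alg
  | While alg alg
  | Run
  | Sim

primrec dsize :: "datum \<Rightarrow> nat" and asize :: "alg \<Rightarrow> nat" where
  "dsize (Num n) = Suc n"
| "dsize (Alg a) = Suc (asize a)"
| "dsize (Lst xs) = Suc (sum_list (map dsize xs))"
| "asize (Prim p) = 1"
| "asize (Const d) = Suc (dsize d)"
| "asize (Comp g f) = Suc (asize g + asize f)"
| "asize (Prepend f g) = Suc (asize f + asize g)"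
| "asize (Cond c f g) = Suc (asize c + asize f + asize g)"
| "asize (While c f) = Suc (asize c + asize f)"
| "asize Run = 1"
| "asize Sim = 1"

fun items :: "datum \<Rightarrow> datum list" where
  "items (Lst xs) = xs"
| "items _ = []"

primrec prim_code :: "prim \<Rightarrow> nat" where
  "prim_code Ident = 0"
| "prim_code Succ = 1"
| "prim_code Pred = 2"
| "prim_code Head = 3"
| "prim_code Tail = 4"
| "prim_code Equal = 5"
| "prim_code Leq = 6"
| "prim_code Kind = 7"
| "prim_code Size = 8"
| "prim_code Reflect = 9"
| "prim_code Reify = 10"

text \<open>One level of the syntax tree of an algorithm, as a list. Through this and its partial inverse
  \<open>Reify\<close>, algorithms can inspect and build algorithms.\<close>

primrec reflect :: "alg \<Rightarrow> datum" where
  "reflect (Prim p) = Lst [Num 0, Num (prim_code p)]"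
| "reflect (Const d) = Lst [Num 1, d]"
| "reflect (Comp g f) = Lst [Num 2, Alg g, Alg f]"
| "reflect (Prepend f g) = Lst [Num 3, Alg f, Alg g]"
| "reflect (Cond c f g) = Lst [Num 4, Alg c, Alg f, Alg g]"
| "reflect (While c f) = Lst [Num 5, Alg c, Alg f]"
| "reflect Run = Lst [Num 6]"
| "reflect Sim = Lst [Num 7]"

lemma inj_reflect: "inj reflect"
proof (rule injI)
  have pc: "prim_code p = prim_code q \<Longrightarrow> p = q" for p q
    by (cases p; cases q) simp_all
  show "a = b" if "reflect a = reflect b" for a b
    using that by (cases a; cases b) (auto dest: pc)
qed

fun prim_fun :: "prim \<Rightarrow> datum \<Rightarrow> datum" where
  "prim_fun Ident u = u"
| "prim_fun Succ u = (case u of Num n \<Rightarrow> Num (Suc n) | _ \<Rightarrow> Num 0)"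
| "prim_fun Pred u = (case u of Num n \<Rightarrow> Num (n - 1) | _ \<Rightarrow> Num 0)"
| "prim_fun Head u = (case items u of [] \<Rightarrow> Num 0 | x # xs \<Rightarrow> x)"
| "prim_fun Tail u = Lst (tl (items u))"
| "prim_fun Equal u = Num (case items u of [x, y] \<Rightarrow> if x = y then 1 else 0 | _ \<Rightarrow> 0)"
| "prim_fun Leq u = Num (case items u of [Num m, Num n] \<Rightarrow> if m \<le> n then 1 else 0 | _ \<Rightarrow> 0)"
| "prim_fun Kind u = Num (case u of Num _ \<Rightarrow> 0 | Alg _ \<Rightarrow> 1 | Lst _ \<Rightarrow> 2)"
| "prim_fun Size u = Num (dsize u)"
| "prim_fun Reflect u = (case u of Alg a \<Rightarrow> reflect a | _ \<Rightarrow> Num 0)"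
| "prim_fun Reify u = (if u \<in> range reflect then Alg (inv reflect u) else Num 0)"

text \<open>\<open>exec n a u = Some (v, r)\<close> means that algorithm \<open>a\<close>, started on input \<open>u\<close> with \<open>n\<close> units of
  time available, halts with output \<open>v\<close> and leaves \<open>r\<close> units unused, so that its runtime is
  \<open>n - r\<close>; \<open>None\<close> means that the time does not suffice. Each algorithm pays one unit on top of the
  runtimes of the subprocesses that it executes. The occurrences of \<open>min\<close> only serve the
  termination proof, see \<open>exec_less\<close> below. \<open>Run\<close> is the universal algorithm; \<open>Sim\<close> is the clocked
  universal algorithm, which reports whether a process halts within a given time. \<open>Run\<close> does not
  halt on inputs of the wrong shape.\<close>

fun exec :: "nat \<Rightarrow> alg \<Rightarrow> datum \<Rightarrow> (datum \<times> nat) option" where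
  "exec 0 a u = None"
| "exec (Suc n) (Prim p) u = Some (prim_fun p u, n)"
| "exec (Suc n) (Const d) u = Some (d, n)"
| "exec (Suc n) (Comp g f) u =
     (case exec n f u of None \<Rightarrow> None | Some (v, r) \<Rightarrow> exec (min r n) g v)"
| "exec (Suc n) (Prepend f g) u =
     (case exec n f u of None \<Rightarrow> None | Some (x, r) \<Rightarrow>
       (case exec (min r n) g u of None \<Rightarrow> None | Some (y, s) \<Rightarrow> Some (Lst (x # items y), s)))"
| "exec (Suc n) (Cond c f g) u =
     (case exec n c u of None \<Rightarrow> None | Some (b, r) \<Rightarrow>
       if b \<noteq> Num 0 then exec (min r n) f u else exec (min r n) g u)"
| "exec (Suc n) (While c f) u =
     (case exec n c u of None \<Rightarrow> None | Some (b, r) \<Rightarrow>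
       if b \<noteq> Num 0 then
         (case exec (min r n) f u of None \<Rightarrow> None | Some (v, s) \<Rightarrow> exec (min s n) (While c f) v)
       else Some (u, r))"
| "exec (Suc n) Run u = (case items u of [Alg a, v] \<Rightarrow> exec n a v | _ \<Rightarrow> None)"
| "exec (Suc n) Sim u =
     (case items u of
        [Alg a, v, Num t] \<Rightarrow>
          if t \<le> n then
            Some (case exec t a v of None \<Rightarrow> Lst [] | Some (w, r) \<Rightarrow> Lst [w], n - t)
          else None
      | _ \<Rightarrow> Some (Lst [], n))"

definition halts :: "alg \<Rightarrow> datum \<Rightarrow> datum \<Rightarrow> bool" where
  "halts a u v \<longleftrightarrow> (\<exists>n r. exec n a u = Some (v, r))"

lemma exec_less: "exec n a u = Some (v, r) \<Longrightarrow> r < n"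
proof (induction n a u arbitrary: v r rule: exec.induct)
qed (fastforce split: option.splits if_splits list.splits datum.splits prod.splits)+

lemma exec_Comp:
  "exec (Suc n) (Comp g f) u =
     (case exec n f u of None \<Rightarrow> None | Some (v, r) \<Rightarrow> exec r g v)"
  by (auto split: option.splits dest: exec_less simp: min_absorb1)

lemma exec_Prepend:
  "exec (Suc n) (Prepend f g) u =
     (case exec n f u of None \<Rightarrow> None | Some (x, r) \<Rightarrow>
       (case exec r g u of None \<Rightarrow> None | Some (y, s) \<Rightarrow> Some (Lst (x # items y), s)))"
proof (cases "exec n f u")
  case (Some p)
  then obtain x r where p: "exec n f u = Some (x, r)" by (cases p) auto
  with exec_less have "min r n = r" by fastforce
  with p show ?thesis by simp
qed simp

lemma exec_Cond:
  "exec (Suc n) (Cond c f g) u =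
     (case exec n c u of None \<Rightarrow> None | Some (b, r) \<Rightarrow>
       if b \<noteq> Num 0 then exec r f u else exec r g u)"
  by (auto split: option.splits dest: exec_less simp: min_absorb1)

lemma exec_While:
  "exec (Suc n) (While c f) u =
     (case exec n c u of None \<Rightarrow> None | Some (b, r) \<Rightarrow>
       if b \<noteq> Num 0 then
         (case exec r f u of None \<Rightarrow> None | Some (v, s) \<Rightarrow> exec s (While c f) v)
       else Some (u, r))"
proof (cases "exec n c u")
  case (Some p)
  then obtain b r where p: "exec n c u = Some (b, r)" by (cases p) auto
  with exec_less have r: "r < n" by blast
  show ?thesis
  proof (cases "exec r f u")
    case (Some q)
    then obtain v s where q: "exec r f u = Some (v, s)" by (cases q) auto
    with exec_less have "s < r" by blast
    with r p q show ?thesis by (simp add: min_absorb1)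
  qed (use p r in \<open>simp add: min_absorb1\<close>)
qed simp

declare exec.simps(4-7) [simp del]
declare exec_Comp [simp] exec_Prepend [simp] exec_Cond [simp] exec_While [simp]

lemma exec_add: "exec n a u = Some (v, r) \<Longrightarrow> exec (n + k) a u = Some (v, r + k)"
proof (induction n arbitrary: a u v r rule: less_induct)
  case (less n)
  then obtain n' where n: "n = Suc n'" by (cases n) auto
  have IH: "exec i a u = Some (v, r) \<Longrightarrow> exec (i + k) a u = Some (v, r + k)"
    if "i \<le> n'" for i a u v r
    using less.IH n that by auto
  show ?case
  proof (cases a)
    case (Comp g f)
    with less.prems n obtain x s where
      1: "exec n' f u = Some (x, s)" and 2: "exec s g x = Some (v, r)"
      by (auto split: option.splits)
    have "s \<le> n'" using exec_less[OF 1] by simp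
    then show ?thesis using IH[OF _ 1] IH[OF _ 2] by (simp add: n Comp)
  next
    case (Prepend f g)
    with less.prems n obtain x s y where
      1: "exec n' f u = Some (x, s)" and 2: "exec s g u = Some (y, r)" and
      v: "v = Lst (x # items y)"
      by (auto split: option.splits)
    have "s \<le> n'" using exec_less[OF 1] by simp
    then show ?thesis using IH[OF _ 1] IH[OF _ 2] by (simp add: n Prepend v)
  next
    case (Cond c f g)
    with less.prems n obtain b s where
      1: "exec n' c u = Some (b, s)" and 2: "exec s (if b \<noteq> Num 0 then f else g) u = Some (v, r)"
      by (auto split: option.splits if_splits)
    have "s \<le> n'" using exec_less[OF 1] by simp
    then show ?thesis using IH[OF _ 1] IH[OF _ 2] by (auto simp add: n Cond)
  next
    case (While c f)
    with less.prems n obtain b s where 1: "exec n' c u = Some (b, s)"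
      by (auto split: option.splits)
    have s: "s \<le> n'" using exec_less[OF 1] by simp
    show ?thesis
    proof (cases "b = Num 0")
      case True
      then show ?thesis using less.prems IH[OF _ 1] 1 by (simp add: n While)
    next
      case False
      then obtain x t where
        2: "exec s f u = Some (x, t)" and 3: "exec t (While c f) x = Some (v, r)"
        using less.prems 1 by (auto simp: n While split: option.splits)
      have "t \<le> n'" using exec_less[OF 2] s by simp
      then show ?thesis using False s IH[OF _ 1] IH[OF _ 2] IH[OF _ 3] by (simp add: n While)
    qed
  next
    case Run
    then show ?thesis using less.prems IH
      by (auto simp: n split: option.splits list.splits datum.splits)
  next
    case Sim
    then show ?thesis using less.prems
      by (auto simp: n split: option.splits list.splits datum.splits if_splits)
  qed (use less.prems in \<open>auto simp: n\<close>)
qed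

lemma halts_unique: "halts a u v \<Longrightarrow> halts a u w \<Longrightarrow> v = w"
proof -
  assume "halts a u v" "halts a u w"
  then obtain n r m s where "exec n a u = Some (v, r)" "exec m a u = Some (w, s)"
    by (auto simp: halts_def)
  then have "exec (n + m) a u = Some (v, r + m)" "exec (n + m) a u = Some (w, s + n)"
    using exec_add[of n a u v r m] exec_add[of m a u w s n] by (simp_all add: add.commute)
  then show "v = w" by simp
qed

lemma halts_Prim: "halts (Prim p) u v \<longleftrightarrow> v = prim_fun p u"
proof
  show "halts (Prim p) u v" if "v = prim_fun p u"
    unfolding halts_def by (rule exI[of _ "Suc 0"]) (simp add: that)
qed (auto simp: halts_def elim: exec.elims)

lemma halts_Const: "halts (Const d) u v \<longleftrightarrow> v = d"
proof
  show "halts (Const d) u v" if "v = d"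
    unfolding halts_def by (rule exI[of _ "Suc 0"]) (simp add: that)
qed (auto simp: halts_def elim: exec.elims)

lemma halts_Comp: "halts (Comp g f) u w \<longleftrightarrow> (\<exists>v. halts f u v \<and> halts g v w)" (is "?L \<longleftrightarrow> ?R")
proof
  assume ?L
  then obtain n r where e: "exec n (Comp g f) u = Some (w, r)" by (auto simp: halts_def)
  then obtain n' where "n = Suc n'" by (cases n) auto
  with e show ?R by (auto simp: halts_def split: option.splits)
next
  assume ?R
  then obtain v n r m s where
    "exec n f u = Some (v, r)" "exec m g v = Some (w, s)" by (auto simp: halts_def)
  then have "exec (n + m) f u = Some (v, r + m)" "exec (r + m) g v = Some (w, s + r)"
    using exec_add[of n f u v r m] exec_add[of m g v w s r] by (simp_all add: add.commute)
  then have "exec (Suc (n + m)) (Comp g f) u = Some (w, s + r)" by simp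
  then show ?L unfolding halts_def by blast
qed

lemma halts_Prepend:
  "halts (Prepend f g) u w \<longleftrightarrow> (\<exists>x y. halts f u x \<and> halts g u y \<and> w = Lst (x # items y))"
  (is "?L \<longleftrightarrow> ?R")
proof
  assume ?L
  then obtain n r where e: "exec n (Prepend f g) u = Some (w, r)" by (auto simp: halts_def)
  then obtain n' where "n = Suc n'" by (cases n) auto
  with e show ?R by (fastforce simp: halts_def split: option.splits)
next
  assume ?R
  then obtain x y n r m s where w: "w = Lst (x # items y)" and
    "exec n f u = Some (x, r)" "exec m g u = Some (y, s)" by (auto simp: halts_def)
  then have "exec (n + m) f u = Some (x, r + m)" "exec (r + m) g u = Some (y, s + r)"
    using exec_add[of n f u x r m] exec_add[of m g u y s r] by (simp_all add: add.commute)
  then have "exec (Suc (n + m)) (Prepend f g) u = Some (w, s + r)" by (simp add: w)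
  then show ?L unfolding halts_def by blast
qed

lemma halts_Cond:
  "halts (Cond c f g) u w \<longleftrightarrow>
     (\<exists>b. halts c u b \<and> (if b \<noteq> Num 0 then halts f u w else halts g u w))"
  (is "?L \<longleftrightarrow> ?R")
proof
  assume ?L
  then obtain n r where e: "exec n (Cond c f g) u = Some (w, r)" by (auto simp: halts_def)
  then obtain n' where "n = Suc n'" by (cases n) auto
  with e obtain b s where "exec n' c u = Some (b, s)"
    "exec s (if b \<noteq> Num 0 then f else g) u = Some (w, r)"
    by (auto split: option.splits if_splits)
  then have "halts c u b" "halts (if b \<noteq> Num 0 then f else g) u w"
    unfolding halts_def by blast+
  then show ?R by (auto split: if_splits)
next
  assume ?R
  then obtain b n r m s where
    "exec n c u = Some (b, r)" "exec m (if b \<noteq> Num 0 then f else g) u = Some (w, s)"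
    by (auto simp: halts_def split: if_splits)
  then have "exec (n + m) c u = Some (b, r + m)"
      "exec (r + m) (if b \<noteq> Num 0 then f else g) u = Some (w, s + r)"
    using exec_add[of n c u b r m] exec_add[of m "if b \<noteq> Num 0 then f else g" u w s r]
    by (simp_all add: add.commute)
  then have "exec (Suc (n + m)) (Cond c f g) u = Some (w, s + r)" by (auto split: if_splits)
  then show ?L unfolding halts_def by blast
qed

lemma halts_While:
  "halts (While c f) u w \<longleftrightarrow>
     (\<exists>b. halts c u b \<and>
        (if b \<noteq> Num 0 then \<exists>v. halts f u v \<and> halts (While c f) v w else w = u))"
  (is "?L \<longleftrightarrow> ?R")
proof
  assume ?L
  then obtain n r where e: "exec n (While c f) u = Some (w, r)" by (auto simp: halts_def)
  then obtain n' where "n = Suc n'" by (cases n) auto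
  with e obtain b s where b: "exec n' c u = Some (b, s)"
    and w: "if b \<noteq> Num 0 then (case exec s f u of None \<Rightarrow> None
              | Some (v, t) \<Rightarrow> exec t (While c f) v) = Some (w, r) else w = u"
    by (auto split: option.splits if_splits)
  have "\<exists>v. halts f u v \<and> halts (While c f) v w" if "b \<noteq> Num 0"
  proof -
    from w that obtain v t where "exec s f u = Some (v, t)" "exec t (While c f) v = Some (w, r)"
      by (auto split: option.splits)
    then show ?thesis unfolding halts_def by blast
  qed
  moreover have "halts c u b" using b unfolding halts_def by blast
  moreover have "w = u" if "b = Num 0" using w that by simp
  ultimately show ?R by (intro exI[of _ b]) (simp split: if_split)
next
  assume ?R
  then obtain b where b: "halts c u b"
    and R: "if b \<noteq> Num 0 then \<exists>v. halts f u v \<and> halts (While c f) v w else w = u" by blast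
  from b obtain n r where 1: "exec n c u = Some (b, r)" by (auto simp: halts_def)
  show ?L
  proof (cases "b = Num 0")
    case True
    then have "exec (Suc n) (While c f) u = Some (w, r)" using 1 R by simp
    then show ?thesis unfolding halts_def by blast
  next
    case False
    then obtain v where "halts f u v" "halts (While c f) v w" using R by auto
    then obtain m s l t where 2: "exec m f u = Some (v, s)" and
      3: "exec l (While c f) v = Some (w, t)" by (auto simp: halts_def)
    have "exec (n + (m + l)) c u = Some (b, r + (m + l))" using exec_add[OF 1] .
    moreover have "exec (r + (m + l)) f u = Some (v, s + (r + l))"
      using exec_add[OF 2, of "r + l"] by (simp add: ac_simps)
    moreover have "exec (s + (r + l)) (While c f) v = Some (w, t + (s + r))"
      using exec_add[OF 3, of "s + r"] by (simp add: ac_simps)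
    ultimately have "exec (Suc (n + (m + l))) (While c f) u = Some (w, t + (s + r))"
      using False by simp
    then show ?thesis unfolding halts_def by blast
  qed
qed

lemma halts_Run: "halts Run u w \<longleftrightarrow> (\<exists>a v. u = Lst [Alg a, v] \<and> halts a v w)" (is "?L \<longleftrightarrow> ?R")
proof
  assume ?L
  then obtain n r where e: "exec n Run u = Some (w, r)" by (auto simp: halts_def)
  then obtain n' where "n = Suc n'" by (cases n) auto
  with e show ?R by (cases u) (auto simp: halts_def split: list.splits datum.splits)
next
  assume ?R
  then obtain a v n r where u: "u = Lst [Alg a, v]" and "exec n a v = Some (w, r)"
    by (auto simp: halts_def)
  then have "exec (Suc n) Run u = Some (w, r)" by simp
  then show ?L unfolding halts_def by blast
qed

lemma halts_Sim:
  "halts Sim u w \<longleftrightarrow>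
     w = (case items u of
            [Alg a, v, Num t] \<Rightarrow> (case exec t a v of None \<Rightarrow> Lst [] | Some (x, r) \<Rightarrow> Lst [x])
          | _ \<Rightarrow> Lst [])" (is "?L \<longleftrightarrow> ?R")
proof
  assume ?L
  then obtain n r where e: "exec n Sim u = Some (w, r)" by (auto simp: halts_def)
  then obtain n' where "n = Suc n'" by (cases n) auto
  with e show ?R by (auto split: list.splits datum.splits if_splits)
next
  assume R: ?R
  define n where "n = (case items u of [Alg a, v, Num t] \<Rightarrow> t | _ \<Rightarrow> 0)"
  have "exec (Suc n) Sim u = Some (w, 0)"
    using R by (auto simp: n_def split: list.splits datum.splits)
  then show ?L unfolding halts_def by blast
qed

lemma dsize_pos: "dsize d > 0"
  by (cases d) auto

lemma dsize_Lst_gt: "sum_list (map dsize xs) < dsize (Lst xs)"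
  by simp

lemma finite_dsize: "finite {d. dsize d \<le> n}"
proof -
  have pos: "asize a > 0" for a by (cases a) auto
  have len: "length xs \<le> sum_list (map dsize xs)" for xs
  proof (induction xs)
    case (Cons x xs)
    then show ?case using dsize_pos[of x] by simp
  qed simp
  have mem: "x \<in> set xs \<Longrightarrow> dsize x \<le> sum_list (map dsize xs)" for x xs
    by (simp add: member_le_sum_list)
  have "finite {d. dsize d \<le> n} \<and> finite {a. asize a \<le> n}"
  proof (induction n)
    case 0
    have *: "(dsize d = 0) = False" "(asize a = 0) = False" for d a
      using dsize_pos[of d] pos[of a] by simp_all
    show ?case by (simp add: *)
  next
    case (Suc n)
    let ?D = "{d. dsize d \<le> n}" and ?A = "{a. asize a \<le> n}"
    have "{d. dsize d \<le> Suc n} \<subseteq>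
        Num ` {..n} \<union> Alg ` ?A \<union> Lst ` {xs. set xs \<subseteq> ?D \<and> length xs \<le> n}"
      (is "_ \<subseteq> ?R")
    proof
      fix d assume d: "d \<in> {d. dsize d \<le> Suc n}"
      show "d \<in> ?R"
      proof (cases d)
        case (Lst xs)
        then have "sum_list (map dsize xs) \<le> n" using d by simp
        then have "set xs \<subseteq> ?D" "length xs \<le> n" using mem len le_trans by blast+
        with Lst show ?thesis by blast
      qed (use d in auto)
    qed
    moreover have "finite ?R"
      using Suc.IH finite_lists_length_le[of ?D n] by simp
    moreover have "{a. asize a \<le> Suc n} \<subseteq> Prim ` {Ident, Succ, Pred, Head, Tail, Equal, Leq,
        Kind, Size, Reflect, Reify} \<union> Const ` ?D \<union> case_prod Comp ` (?A \<times> ?A)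
        \<union> case_prod Prepend ` (?A \<times> ?A) \<union> (\<lambda>(c, f, g). Cond c f g) ` (?A \<times> ?A \<times> ?A)
        \<union> case_prod While ` (?A \<times> ?A) \<union> {Run, Sim}" (is "_ \<subseteq> ?S")
    proof
      fix a assume a: "a \<in> {a. asize a \<le> Suc n}"
      show "a \<in> ?S"
      proof (cases a)
        case (Prim p)
        then show ?thesis by (cases p) auto
      next
        case (Comp g f)
        then have "(g, f) \<in> ?A \<times> ?A" using a by simp
        then have "case_prod Comp (g, f) \<in> ?S" by blast
        then show ?thesis by (simp add: Comp)
      next
        case (Prepend g f)
        then have "(g, f) \<in> ?A \<times> ?A" using a by simp
        then have "case_prod Prepend (g, f) \<in> ?S" by blast
        then show ?thesis by (simp add: Prepend)
      next
        case (While g f)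
        then have "(g, f) \<in> ?A \<times> ?A" using a by simp
        then have "case_prod While (g, f) \<in> ?S" by blast
        then show ?thesis by (simp add: While)
      next
        case (Cond c f g)
        then have "(c, f, g) \<in> ?A \<times> ?A \<times> ?A" using a by simp
        then have "(\<lambda>(c, f, g). Cond c f g) (c, f, g) \<in> ?S" by blast
        then show ?thesis by (simp add: Cond)
      qed (use a in auto)
    qed
    moreover have "finite ?S" using Suc.IH by simp
    ultimately show ?case by (meson finite_subset)
  qed
  then show ?thesis by simp
qed

section \<open>Algorithmic statements, rules and libraries\<close>

definition stmt :: "alg \<Rightarrow> datum \<Rightarrow> datum \<Rightarrow> datum" where
  "stmt a u v = Lst [Alg a, u, v]"

definition Stmts :: "datum set" where
  "Stmts = {A. \<exists>a u v. A = stmt a u v}"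

definition true_stmt :: "datum \<Rightarrow> bool" where
  "true_stmt A \<longleftrightarrow> (\<exists>a u v. A = stmt a u v \<and> halts a u v)"

definition false_stmt :: "datum \<Rightarrow> bool" where
  "false_stmt A \<longleftrightarrow> A \<in> Stmts \<and> \<not> true_stmt A"

definition directly_false :: "datum \<Rightarrow> bool" where
  "directly_false A \<longleftrightarrow> (\<exists>a u v w. A = stmt a u v \<and> halts a u w \<and> w \<noteq> v)"

definition falsum :: datum where
  "falsum = stmt (Prim Ident) (Num 0) (Num 1)"

definition algorithmic_sequence :: "alg \<Rightarrow> bool" where
  "algorithmic_sequence \<rho> \<longleftrightarrow> (\<forall>n>0. \<exists>v. halts \<rho> (Num n) v)"

definition rule_input :: "datum list \<Rightarrow> alg \<Rightarrow> nat \<Rightarrow> datum" where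
  "rule_input H \<rho> m = Lst [Lst H, Alg \<rho>, Num m]"

definition is_rule :: "alg \<Rightarrow> bool" where
  "is_rule r \<longleftrightarrow>
     (\<forall>H \<rho> m. set H \<subseteq> Stmts \<and> algorithmic_sequence \<rho> \<and> m > 0 \<longrightarrow>
        (\<exists>K. set K \<subseteq> Stmts \<and> halts r (rule_input H \<rho> m) (Lst (H @ K)))) \<and>
     (\<forall>H H' \<rho> m m' L L'.
        set H \<subseteq> Stmts \<and> set H' \<subseteq> Stmts \<and> algorithmic_sequence \<rho> \<and> m > 0 \<and>
        m' \<ge> m \<and> set H \<subseteq> set H' \<and>
        halts r (rule_input H \<rho> m) (Lst L) \<and> halts r (rule_input H' \<rho> m') (Lst L') \<longrightarrow>
        set L \<subseteq> set L')"

definition library :: "alg \<Rightarrow> bool" where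
  "library \<rho> \<longleftrightarrow> (\<forall>n>0. \<exists>r. is_rule r \<and> halts \<rho> (Num n) (Alg r))"

definition rules_of :: "alg \<Rightarrow> alg set" where
  "rules_of \<rho> = {r. \<exists>n>0. halts \<rho> (Num n) (Alg r)}"

definition rule_valid :: "alg \<Rightarrow> alg \<Rightarrow> bool" where
  "rule_valid \<rho> r \<longleftrightarrow>
     (\<forall>H m L. (\<forall>A\<in>set H. true_stmt A) \<and> m > 0 \<and> halts r (rule_input H \<rho> m) (Lst L) \<longrightarrow>
        (\<forall>A\<in>set L. true_stmt A))"

definition valid_library :: "alg \<Rightarrow> bool" where
  "valid_library \<rho> \<longleftrightarrow> library \<rho> \<and> (\<forall>r\<in>rules_of \<rho>. rule_valid \<rho> r)"


section \<open>Bases\<close>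

definition base :: "alg set \<Rightarrow> bool" where
  "base \<B> \<longleftrightarrow> (\<forall>r\<in>\<B>. is_rule r) \<and> (finite \<B> \<or> (\<exists>\<rho>. library \<rho> \<and> \<B> = rules_of \<rho>))"

definition base_library :: "alg set \<Rightarrow> alg \<Rightarrow> bool" where
  "base_library \<B> \<rho> \<longleftrightarrow> library \<rho> \<and> \<B> \<subseteq> rules_of \<rho>"

definition valid_outside :: "alg set \<Rightarrow> alg \<Rightarrow> bool" where
  "valid_outside \<B> \<rho> \<longleftrightarrow> (\<forall>r\<in>rules_of \<rho> - \<B>. rule_valid \<rho> r)"

definition stable_base :: "alg set \<Rightarrow> bool" where
  "stable_base \<B> \<longleftrightarrow>
     base \<B> \<and> (\<forall>\<rho>. base_library \<B> \<rho> \<and> valid_outside \<B> \<rho> \<longrightarrow> valid_library \<rho>)"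


section \<open>Deduction, negation and disjunction\<close>

definition recursive_bijection :: "(nat \<Rightarrow> nat \<times> nat) \<Rightarrow> bool" where
  "recursive_bijection f \<longleftrightarrow>
     bij_betw f {0<..} ({0<..} \<times> {0<..}) \<and>
     (\<exists>a. \<forall>i>0. halts a (Num i) (Lst [Num (fst (f i)), Num (snd (f i))]))"

definition result :: "alg \<Rightarrow> datum \<Rightarrow> datum" where
  "result a u = (THE v. halts a u v)"

definition nth_rule :: "alg \<Rightarrow> nat \<Rightarrow> alg" where
  "nth_rule \<rho> k = (THE r. halts \<rho> (Num k) (Alg r))"

primrec deduction_list ::
  "(nat \<Rightarrow> nat \<times> nat) \<Rightarrow> alg \<Rightarrow> datum list \<Rightarrow> nat \<Rightarrow> datum list" where
  "deduction_list f \<rho> \<Gamma> 0 = \<Gamma>"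
| "deduction_list f \<rho> \<Gamma> (Suc i) =
     (case f (Suc i) of (k, m) \<Rightarrow>
        items (result (nth_rule \<rho> k) (rule_input (deduction_list f \<rho> \<Gamma> i) \<rho> m)))"

text \<open>The algorithms \<open>deduce\<close> and \<open>or\<close> are specified by their input-output behaviour. What \<open>deduce\<close>
  does when its second item is not a library is left open.\<close>

definition implements_deduce :: "(nat \<Rightarrow> nat \<times> nat) \<Rightarrow> alg \<Rightarrow> bool" where
  "implements_deduce f deduce \<longleftrightarrow>
     (\<forall>\<Gamma> \<rho> B. set \<Gamma> \<subseteq> Stmts \<and> library \<rho> \<and> B \<in> Stmts \<longrightarrow>
        (if \<exists>i>0. B \<in> set (deduction_list f \<rho> \<Gamma> i)
         then halts deduce (Lst [Lst \<Gamma>, Alg \<rho>, B]) (Num 1)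
         else \<nexists>v. halts deduce (Lst [Lst \<Gamma>, Alg \<rho>, B]) v))"

definition implements_or :: "alg \<Rightarrow> bool" where
  "implements_or or_alg \<longleftrightarrow>
     (\<forall>A\<in>Stmts. \<forall>B\<in>Stmts.
        if true_stmt A \<or> true_stmt B then halts or_alg (Lst [A, B]) (Num 1)
        else if directly_false A \<and> directly_false B then halts or_alg (Lst [A, B]) (Num 0)
        else \<nexists>v. halts or_alg (Lst [A, B]) v)"

definition entails :: "alg \<Rightarrow> datum list \<Rightarrow> datum \<Rightarrow> datum \<Rightarrow> datum" where
  "entails deduce \<Gamma> \<rho> B = stmt deduce (Lst [Lst \<Gamma>, \<rho>, B]) (Num 1)"

definition implies :: "alg \<Rightarrow> datum \<Rightarrow> datum \<Rightarrow> datum \<Rightarrow> datum" where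
  "implies deduce A \<rho> B = entails deduce [A] \<rho> B"

definition neg :: "alg \<Rightarrow> datum \<Rightarrow> datum \<Rightarrow> datum" where
  "neg deduce \<rho> A = implies deduce A \<rho> falsum"

definition disj :: "alg \<Rightarrow> datum \<Rightarrow> datum \<Rightarrow> datum" where
  "disj or_alg A B = stmt or_alg (Lst [A, B]) (Num 1)"


section \<open>Premise-free rules\<close>

text \<open>\<open>Y \<rho> A\<close> is the instance of the conclusion of the diagram for the nominal library \<open>\<rho>\<close> and the
  value \<open>A\<close> of its only letter. The order in which the instances are appended is unspecified.\<close>

definition implements_premise_free :: "(datum \<Rightarrow> datum \<Rightarrow> datum) \<Rightarrow> alg \<Rightarrow> bool" where
  "implements_premise_free Y r \<longleftrightarrow>
     (\<forall>H \<rho> m. set H \<subseteq> Stmts \<and> algorithmic_sequence \<rho> \<and> m > 0 \<longrightarrow>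
        (\<exists>K. halts r (rule_input H \<rho> m) (Lst (H @ K)) \<and>
             set K = {Y (Alg \<rho>) A |A. A \<in> Stmts \<and> dsize (Y (Alg \<rho>) A) \<le> m}))"

definition implements_P8 :: "alg \<Rightarrow> alg \<Rightarrow> alg \<Rightarrow> bool" where
  "implements_P8 deduce or_alg = implements_premise_free (\<lambda>\<rho> A. disj or_alg A (neg deduce \<rho> A))"

definition implements_P9 :: "alg \<Rightarrow> alg \<Rightarrow> alg \<Rightarrow> bool" where
  "implements_P9 deduce or_alg = implements_premise_free
     (\<lambda>\<rho> A. disj or_alg (neg deduce \<rho> A) (neg deduce \<rho> (neg deduce \<rho> A)))"


section \<open>The specifications can be met\<close>

definition computable :: "(datum \<Rightarrow> datum) \<Rightarrow> bool" where
  "computable g \<longleftrightarrow> (\<exists>a. \<forall>u. halts a u (g u))"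

definition decidable :: "(datum \<Rightarrow> bool) \<Rightarrow> bool" where
  "decidable P \<longleftrightarrow> computable (\<lambda>u. Num (of_bool (P u)))"

lemma computable_id: "computable (\<lambda>u. u)"
  unfolding computable_def by (rule exI[of _ "Prim Ident"]) (simp add: halts_Prim)

lemma computable_const: "computable (\<lambda>u. d)"
  unfolding computable_def by (rule exI[of _ "Const d"]) (simp add: halts_Const)

lemma computable_comp:
  assumes "computable g" "computable f"
  shows "computable (\<lambda>u. g (f u))"
proof -
  from assms obtain a b where "\<forall>u. halts a u (g u)" "\<forall>u. halts b u (f u)"
    by (auto simp: computable_def)
  then have "\<forall>u. halts (Comp a b) u (g (f u))" by (auto simp: halts_Comp)
  then show ?thesis unfolding computable_def by blast
qed

lemma computable_prim:
  assumes "computable f"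
  shows "computable (\<lambda>u. prim_fun p (f u))"
proof (rule computable_comp[OF _ assms])
  show "computable (prim_fun p)"
    unfolding computable_def by (rule exI[of _ "Prim p"]) (simp add: halts_Prim)
qed

lemma computable_Cons_items:
  assumes "computable f" "computable g"
  shows "computable (\<lambda>u. Lst (f u # items (g u)))"
proof -
  from assms obtain a b where "\<forall>u. halts a u (f u)" "\<forall>u. halts b u (g u)"
    by (auto simp: computable_def)
  then have "\<forall>u. halts (Prepend a b) u (Lst (f u # items (g u)))" by (auto simp: halts_Prepend)
  then show ?thesis unfolding computable_def by blast
qed

lemma computable_Cons:
  assumes "computable f" "computable (\<lambda>u. Lst (xs u))"
  shows "computable (\<lambda>u. Lst (f u # xs u))"
  using computable_Cons_items[OF assms] by simp

lemma computable_if: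
  assumes "decidable P" "computable f" "computable g"
  shows "computable (\<lambda>u. if P u then f u else g u)"
proof -
  from assms obtain c a b where "\<forall>u. halts c u (Num (of_bool (P u)))"
    "\<forall>u. halts a u (f u)" "\<forall>u. halts b u (g u)"
    by (auto simp: computable_def decidable_def)
  then have h: "halts c u (Num (of_bool (P u)))" "halts a u (f u)" "halts b u (g u)" for u
    by blast+
  have "\<forall>u. halts (Cond c a b) u (if P u then f u else g u)"
  proof
    show "halts (Cond c a b) u (if P u then f u else g u)" for u
      using h[of u] by (cases "P u") (auto simp: halts_Cond)
  qed
  then show ?thesis unfolding computable_def by blast
qed

lemma computable_hd: "computable f \<Longrightarrow> computable (\<lambda>u. prim_fun Head (f u))"
  and computable_tl: "computable f \<Longrightarrow> computable (\<lambda>u. prim_fun Tail (f u))"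
  by (erule computable_prim)+

lemma decidable_eq:
  assumes "computable f" "computable g"
  shows "decidable (\<lambda>u. f u = g u)"
proof -
  have "computable (\<lambda>u. prim_fun Equal (Lst [f u, g u]))"
    by (intro computable_prim computable_Cons computable_const assms)
  then show ?thesis by (simp add: decidable_def of_bool_def)
qed

lemma decidable_le:
  assumes "computable (\<lambda>u. Num (f u))" "computable (\<lambda>u. Num (g u))"
  shows "decidable (\<lambda>u. f u \<le> g u)"
proof -
  have "computable (\<lambda>u. prim_fun Leq (Lst [Num (f u), Num (g u)]))"
    by (intro computable_prim computable_Cons computable_const assms)
  then show ?thesis by (simp add: decidable_def of_bool_def)
qed

lemma decidable_not:
  assumes "decidable P"
  shows "decidable (\<lambda>u. \<not> P u)"
proof -
  have "computable (\<lambda>u. if P u then Num 0 else Num 1)"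
    using assms by (intro computable_if computable_const)
  moreover have "(\<lambda>u. if P u then Num 0 else Num 1) = (\<lambda>u. Num (of_bool (\<not> P u)))"
    by auto
  ultimately show ?thesis by (simp add: decidable_def)
qed

lemma decidable_conj:
  assumes "decidable P" "decidable Q"
  shows "decidable (\<lambda>u. P u \<and> Q u)"
proof -
  have "computable (\<lambda>u. if P u then Num (of_bool (Q u)) else Num 0)"
    using assms by (intro computable_if) (auto simp: decidable_def computable_const)
  moreover have "(\<lambda>u. if P u then Num (of_bool (Q u)) else Num 0) = (\<lambda>u. Num (of_bool (P u \<and> Q u)))"
    by auto
  ultimately show ?thesis by (simp add: decidable_def)
qed

lemma decidable_disj: "decidable P \<Longrightarrow> decidable Q \<Longrightarrow> decidable (\<lambda>u. P u \<or> Q u)"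
  using decidable_not[OF decidable_conj[OF decidable_not decidable_not], of P Q] by simp

lemmas computable_intros =
  computable_id computable_const computable_prim computable_Cons_items computable_Cons
  computable_if decidable_eq decidable_not decidable_conj decidable_disj

lemma exec_halts: "exec n a u = Some (v, r) \<Longrightarrow> halts a u w \<Longrightarrow> v = w"
  using halts_unique[of a u v w] by (auto simp: halts_def)

lemma halts_While_sequence:
  assumes c: "\<And>i. halts c (S i) (Num (of_bool (P i)))"
    and b: "\<And>i. halts b (S i) (S (Suc i))"
  shows "halts (While c b) (S 0) w \<longleftrightarrow> (\<exists>k. w = S k \<and> \<not> P k \<and> (\<forall>j<k. P j))"
proof -
  have "halts (While c b) (S i) w \<longleftrightarrow> (\<exists>k\<ge>i. w = S k \<and> \<not> P k \<and> (\<forall>j. i \<le> j \<and> j < k \<longrightarrow> P j))" for i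
  proof
    have "exec n (While c b) (S i) = Some (w, r) \<Longrightarrow>
        \<exists>k\<ge>i. w = S k \<and> \<not> P k \<and> (\<forall>j. i \<le> j \<and> j < k \<longrightarrow> P j)" for n r
    proof (induction n arbitrary: i rule: less_induct)
      case (less n)
      then obtain n' where n: "n = Suc n'" by (cases n) auto
      with less.prems obtain d s where 1: "exec n' c (S i) = Some (d, s)"
        by (auto split: option.splits)
      then have d: "d = Num (of_bool (P i))" using c exec_halts by blast
      show ?case
      proof (cases "P i")
        case False
        then have "w = S i" using less.prems 1 d n by simp
        with False show ?thesis by auto
      next
        case True
        then obtain v t where 2: "exec s b (S i) = Some (v, t)" and
          3: "exec t (While c b) v = Some (w, r)"
          using less.prems 1 d n by (auto split: option.splits)
        then have v: "v = S (Suc i)" using b exec_halts by blast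
        have "t < n" using exec_less[OF 1] exec_less[OF 2] n by simp
        from less.IH[OF this 3[unfolded v]] obtain k where
          "k \<ge> Suc i" "w = S k" "\<not> P k" "\<forall>j. Suc i \<le> j \<and> j < k \<longrightarrow> P j" by blast
        moreover have "\<forall>j. i \<le> j \<and> j < k \<longrightarrow> P j"
          using True calculation(4) by (metis Suc_leI le_neq_implies_less)
        ultimately show ?thesis by (intro exI[of _ k]) simp
      qed
    qed
    then show "halts (While c b) (S i) w \<Longrightarrow>
        \<exists>k\<ge>i. w = S k \<and> \<not> P k \<and> (\<forall>j. i \<le> j \<and> j < k \<longrightarrow> P j)"
      by (auto simp: halts_def)
  next
    assume "\<exists>k\<ge>i. w = S k \<and> \<not> P k \<and> (\<forall>j. i \<le> j \<and> j < k \<longrightarrow> P j)"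
    then obtain k where k: "k \<ge> i" "w = S k" "\<not> P k" "\<forall>j. i \<le> j \<and> j < k \<longrightarrow> P j" by blast
    have "halts (While c b) (S j) w" if "i \<le> j" "j \<le> k" for j
      using that(2,1)
    proof (induction j rule: inc_induct)
      case base
      show ?case using c[of k] k by (subst halts_While) auto
    next
      case (step j)
      then have "P j" "halts (While c b) (S (Suc j)) w" using k by auto
      then show ?case using b[of j] c[of j] by (subst halts_While) auto
    qed
    then show "halts (While c b) (S i) w" using k(1) by blast
  qed
  from this[of 0] show ?thesis by simp
qed

lemma computable_while:
  assumes P: "decidable P" and s: "computable s" and fin: "\<And>u. \<exists>k. \<not> P ((s ^^ k) u)"
  shows "computable (\<lambda>u. (s ^^ (LEAST k. \<not> P ((s ^^ k) u))) u)"
proof -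
  from P s obtain c b where c: "\<And>u. halts c u (Num (of_bool (P u)))"
    and b: "\<And>u. halts b u (s u)" by (auto simp: decidable_def computable_def)
  have "halts (While c b) u ((s ^^ (LEAST k. \<not> P ((s ^^ k) u))) u)" for u
  proof -
    have "\<not> P ((s ^^ (LEAST k. \<not> P ((s ^^ k) u))) u)" using fin by (rule LeastI_ex)
    moreover have "\<forall>j<(LEAST k. \<not> P ((s ^^ k) u)). P ((s ^^ j) u)"
      using not_less_Least by blast
    ultimately show ?thesis
      using halts_While_sequence[of c "\<lambda>i. (s ^^ i) u" "\<lambda>i. P ((s ^^ i) u)" b] b c by auto
  qed
  then show ?thesis unfolding computable_def by blast
qed

lemma computable_fold:
  assumes G: "computable G" and X: "computable X" and A: "computable A" and E: "computable E"
  shows "computable (\<lambda>u. fold (\<lambda>x acc. G (Lst [x, acc, E u])) (items (X u)) (A u))"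
proof -
  let ?h = "prim_fun Head" and ?t = "prim_fun Tail"
  define s where "s w = Lst [?t (?h w), G (Lst [?h (?h w), ?h (?t w), ?h (?t (?t w))]),
     ?h (?t (?t w))]" for w
  define P where "P w \<longleftrightarrow> Lst (items (?h w)) \<noteq> Lst []" for w
  define L where "L w = (LEAST k. \<not> P ((s ^^ k) w))" for w
  have "computable (\<lambda>w. Lst (tl (Num 0 # items (?h w))))"
    using computable_prim[OF computable_Cons_items[OF computable_const[of "Num 0"]
        computable_hd[OF computable_id]], of Tail] by simp
  then have dP: "decidable P" unfolding P_def by (intro computable_intros) simp
  have cs: "computable s"
    unfolding s_def by (intro computable_intros computable_comp[OF G])
  have step: "(s ^^ length xs) (Lst [Lst xs, a, e]) =
      Lst [Lst [], fold (\<lambda>x acc. G (Lst [x, acc, e])) xs a, e]" for xs a e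
    by (induction xs arbitrary: a) (simp_all add: s_def funpow_swap1[symmetric] del: funpow.simps
        add: funpow_Suc_right)
  have run: "(s ^^ k) (Lst [Lst xs, a, e]) =
      Lst [Lst (drop k xs), fold (\<lambda>x acc. G (Lst [x, acc, e])) (take k xs) a, e]"
    if "k \<le> length xs" for k xs a e
    using that
  proof (induction k)
    case (Suc k)
    then have "drop k xs = xs ! k # drop (Suc k) xs"
      by (simp add: Cons_nth_drop_Suc)
    with Suc show ?case by (simp add: s_def take_Suc_conv_app_nth)
  qed simp
  have L: "L (Lst [Lst xs, a, e]) = length xs" for xs a e
    unfolding L_def
  proof (rule Least_equality)
    show "\<not> P ((s ^^ length xs) (Lst [Lst xs, a, e]))" by (simp add: run P_def)
    show "length xs \<le> k" if "\<not> P ((s ^^ k) (Lst [Lst xs, a, e]))" for k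
      using that by (rule contrapos_np) (simp add: run P_def)
  qed
  have dec: "\<exists>k. \<not> P ((s ^^ k) w)" for w
  proof -
    have len: "length (items (?h ((s ^^ k) w))) = length (items (?h w)) - k" for k
      by (induction k) (auto simp: s_def)
    have "\<not> P ((s ^^ length (items (?h w))) w)"
      using len[of "length (items (?h w))"] by (simp add: P_def)
    then show ?thesis by blast
  qed
  have W: "computable (\<lambda>w. (s ^^ L w) w)"
    unfolding L_def by (rule computable_while[OF dP cs dec])
  have X': "computable (\<lambda>u. Lst (items (X u)))"
    using computable_prim[OF computable_Cons_items[OF computable_const[of "Num 0"] X], of Tail]
    by simp
  have I: "computable (\<lambda>u. Lst [Lst (items (X u)), A u, E u])"
    by (intro computable_intros X' A E)
  from computable_hd[OF computable_tl[OF computable_comp[OF W I]]]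
  show ?thesis by (simp add: L run)
qed

lemma computable_iterate:
  assumes s: "computable s" and k: "computable (\<lambda>u. Num (k u))" and x: "computable x"
  shows "computable (\<lambda>u. (s ^^ k u) (x u))"
proof -
  let ?h = "prim_fun Head" and ?t = "prim_fun Tail"
  define g where "g w = Lst [s (?h w), prim_fun Pred (?h (?t w))]" for w
  define P where "P w \<longleftrightarrow> prim_fun Leq (Lst [Num 1, ?h (?t w)]) \<noteq> Num 0" for w
  define L where "L w = (LEAST k. \<not> P ((g ^^ k) w))" for w
  have dP: "decidable P" unfolding P_def by (intro computable_intros)
  have cg: "computable g"
    unfolding g_def by (intro computable_intros computable_comp[OF s])
  have run: "(g ^^ j) (Lst [y, Num n]) = Lst [(s ^^ j) y, Num (n - j)]" for j y n
    by (induction j) (auto simp: g_def)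
  have L: "L (Lst [y, Num n]) = n" for y n
    unfolding L_def by (rule Least_equality) (auto simp: run P_def split: if_splits)
  have dec: "\<exists>k. \<not> P ((g ^^ k) w)" for w
  proof -
    define n where "n = (case ?h (?t w) of Num n \<Rightarrow> n | _ \<Rightarrow> 0)"
    have "?h (?t ((g ^^ Suc j) w)) = Num (n - Suc j)" for j
      by (induction j) (auto simp: g_def n_def split: datum.splits)
    then have "\<not> P ((g ^^ Suc n) w)"
      unfolding P_def by (simp del: funpow.simps prim_fun.simps(4,5)) 
    then show ?thesis by blast
  qed
  have W: "computable (\<lambda>w. (g ^^ L w) w)"
    unfolding L_def by (rule computable_while[OF dP cg dec])
  have I: "computable (\<lambda>u. Lst [x u, Num (k u)])"
    by (intro computable_intros x k)
  from computable_hd[OF computable_comp[OF W I]] show ?thesis by (simp add: L run)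
qed

lemma computable_alg:
  assumes "computable g"
  obtains a where "\<And>u v. halts a u v \<longleftrightarrow> v = g u"
  using assms halts_unique unfolding computable_def by metis

lemma exists_implements_or: "\<exists>or_alg. implements_or or_alg"
proof -
  let ?h = "prim_fun Head" and ?t = "prim_fun Tail"
  define sim where "sim u = (case items u of
      [Alg a, v, Num t] \<Rightarrow> (case exec t a v of None \<Rightarrow> Lst [] | Some (x, r) \<Rightarrow> Lst [x])
    | _ \<Rightarrow> Lst [])" for u
  have sim: "computable sim"
    unfolding computable_def sim_def by (rule exI[of _ Sim]) (simp add: halts_Sim)
  define q where "q A t = sim (Lst [?h A, ?h (?t A), t])" for A t
  have q: "computable (\<lambda>u. q (A u) (t u))" if "computable A" "computable t" for A t
    unfolding q_def by (intro computable_comp[OF sim] computable_intros that)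
  define T where "T A t \<longleftrightarrow> q A t = Lst [?h (?t (?t A))]" for A t
  define F where "F A t \<longleftrightarrow> q A t \<noteq> Lst [] \<and> \<not> T A t" for A t
  have dT: "decidable (\<lambda>u. T (A u) (t u))" if "computable A" "computable t" for A t
    unfolding T_def by (intro computable_intros q that)
  have dF: "decidable (\<lambda>u. F (A u) (t u))" if "computable A" "computable t" for A t
    unfolding F_def by (intro computable_intros q dT that)
  have T: "T (stmt a u v) (Num t) \<longleftrightarrow> (\<exists>r. exec t a u = Some (v, r))" for a u v t
    by (auto simp: T_def q_def sim_def stmt_def split: option.splits)
  have F: "F (stmt a u v) (Num t) \<longleftrightarrow> (\<exists>w r. exec t a u = Some (w, r) \<and> w \<noteq> v)" for a u v t
    unfolding F_def T by (auto simp: q_def sim_def stmt_def split: option.splits)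
  define P where "P w \<longleftrightarrow> \<not> ((T (?h w) (?h (?t (?t w))) \<or> T (?h (?t w)) (?h (?t (?t w)))) \<or>
    (F (?h w) (?h (?t (?t w))) \<and> F (?h (?t w)) (?h (?t (?t w)))))" for w
  have "decidable P"
    unfolding P_def by (intro computable_intros dT dF)
  then obtain c where c: "\<And>u v. halts c u v \<longleftrightarrow> v = Num (of_bool (P u))"
    unfolding decidable_def by (rule computable_alg) blast
  have "computable (\<lambda>w. Lst [?h w, ?h (?t w), prim_fun Succ (?h (?t (?t w)))])"
    by (intro computable_intros)
  then obtain b where
    b: "\<And>w v. halts b w v \<longleftrightarrow> v = Lst [?h w, ?h (?t w), prim_fun Succ (?h (?t (?t w)))]"
    by (rule computable_alg) blast
  have "computable (\<lambda>w. Lst [?h w, ?h (?t w), Num 0])"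
    by (intro computable_intros)
  then obtain i where i: "\<And>w v. halts i w v \<longleftrightarrow> v = Lst [?h w, ?h (?t w), Num 0]"
    by (rule computable_alg) blast
  have "computable (\<lambda>w. if T (?h w) (?h (?t (?t w))) \<or> T (?h (?t w)) (?h (?t (?t w)))
      then Num 1 else Num 0)"
    by (intro computable_intros dT)
  then obtain e where e: "\<And>w v. halts e w v \<longleftrightarrow>
      v = (if T (?h w) (?h (?t (?t w))) \<or> T (?h (?t w)) (?h (?t (?t w))) then Num 1 else Num 0)"
    by (rule computable_alg) blast
  define or_alg where "or_alg = Comp e (Comp (While c b) i)"
  have "if true_stmt A \<or> true_stmt B then halts or_alg (Lst [A, B]) (Num 1)
        else if directly_false A \<and> directly_false B then halts or_alg (Lst [A, B]) (Num 0)
        else \<nexists>v. halts or_alg (Lst [A, B]) v" if AB: "A \<in> Stmts" "B \<in> Stmts" for A B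
  proof -
    from AB obtain a u v a' u' v' where A: "A = stmt a u v" and B: "B = stmt a' u' v'"
      by (auto simp: Stmts_def)
    define S where "S k = Lst [A, B, Num k]" for k
    have W: "halts (While c b) (S 0) w \<longleftrightarrow> (\<exists>k. w = S k \<and> \<not> P (S k) \<and> (\<forall>j<k. P (S j)))" for w
      by (rule halts_While_sequence) (simp_all add: b c S_def)
    have halts: "halts or_alg (Lst [A, B]) x \<longleftrightarrow>
        (\<exists>k. \<not> P (S k) \<and> (\<forall>j<k. P (S j)) \<and>
          x = (if T A (Num k) \<or> T B (Num k) then Num 1 else Num 0))" for x
      using W by (auto simp: or_alg_def halts_Comp i e S_def)
    have PS: "P (S k) \<longleftrightarrow> \<not> ((T A (Num k) \<or> T B (Num k)) \<or> F A (Num k) \<and> F B (Num k))" for k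
      by (simp add: P_def S_def)
    have least: "\<exists>k. \<not> P (S k) \<and> (\<forall>j<k. P (S j))" if "\<exists>k. \<not> P (S k)"
      using exists_least_iff[of "\<lambda>k. \<not> P (S k)"] that by auto
    have tA: "true_stmt A \<longleftrightarrow> (\<exists>k. T A (Num k))" and tB: "true_stmt B \<longleftrightarrow> (\<exists>k. T B (Num k))"
      unfolding A B T true_stmt_def halts_def by (auto simp: stmt_def)
    have fA: "directly_false A \<longleftrightarrow> (\<exists>k. F A (Num k))" and fB: "directly_false B \<longleftrightarrow> (\<exists>k. F B (Num k))"
      unfolding A B F directly_false_def halts_def by (auto simp: stmt_def)
    have TFA: "\<not> (T A (Num k) \<and> F A (Num k'))" and TFB: "\<not> (T B (Num k) \<and> F B (Num k'))" for k k'
      unfolding A B T F by (metis halts_def halts_unique)+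
    consider (true) "true_stmt A \<or> true_stmt B"
      | (false) "\<not> (true_stmt A \<or> true_stmt B)" "directly_false A \<and> directly_false B"
      | (none) "\<not> (true_stmt A \<or> true_stmt B)" "\<not> (directly_false A \<and> directly_false B)"
      by blast
    then show ?thesis
    proof cases
      case true
      then have "\<exists>k. \<not> P (S k)" unfolding PS tA tB by blast
      from least[OF this] obtain k where k: "\<not> P (S k)" "\<forall>j<k. P (S j)" by blast
      have "T A (Num k) \<or> T B (Num k)" using k(1) true TFA TFB unfolding PS tA tB by blast
      then have "halts or_alg (Lst [A, B]) (Num 1)" unfolding halts using k by auto
      with true show ?thesis by simp
    next
      case false
      then obtain k l where k: "F A (Num k)" "F B (Num l)" unfolding fA fB by blast
      have mono: "F A (Num (k + l))" "F B (Num (k + l))"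
        using k exec_add[of k a u _ _ l] exec_add[of l a' u' _ _ k] unfolding A B F
        by (metis add.commute)+
      then have "\<exists>k. \<not> P (S k)" unfolding PS by blast
      from least[OF this] obtain k where k: "\<not> P (S k)" "\<forall>j<k. P (S j)" by blast
      have "\<not> (T A (Num k) \<or> T B (Num k))" using false(1) unfolding tA tB by blast
      then have "halts or_alg (Lst [A, B]) (Num 0)" unfolding halts using k by auto
      with false show ?thesis by simp
    next
      case none
      then have "P (S k)" for k unfolding PS tA tB fA fB by blast
      then have "\<nexists>v. halts or_alg (Lst [A, B]) v" unfolding halts by blast
      with none show ?thesis by simp
    qed
  qed
  then show ?thesis unfolding implements_or_def by blast
qed

lemma library_step:
  assumes "library \<rho>" "k > 0" "m > 0" "set H \<subseteq> Stmts"
  shows "halts \<rho> (Num k) (Alg (nth_rule \<rho> k))"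
    and "\<exists>K. set K \<subseteq> Stmts \<and> halts (nth_rule \<rho> k) (rule_input H \<rho> m) (Lst (H @ K)) \<and>
           items (result (nth_rule \<rho> k) (rule_input H \<rho> m)) = H @ K"
proof -
  from assms obtain r where r: "is_rule r" "halts \<rho> (Num k) (Alg r)"
    unfolding library_def by blast
  have "nth_rule \<rho> k = r"
    unfolding nth_rule_def using r(2) halts_unique by blast
  with r show *: "halts \<rho> (Num k) (Alg (nth_rule \<rho> k))" by simp
  have "algorithmic_sequence \<rho>"
    using assms(1) unfolding library_def algorithmic_sequence_def by blast
  then obtain K where K: "set K \<subseteq> Stmts" "halts r (rule_input H \<rho> m) (Lst (H @ K))"
    using r(1)[unfolded is_rule_def, THEN conjunct1] assms(3,4) by blast
  then have "result r (rule_input H \<rho> m) = Lst (H @ K)"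
    unfolding result_def using halts_unique by blast
  with K \<open>nth_rule \<rho> k = r\<close>
  show "\<exists>K. set K \<subseteq> Stmts \<and> halts (nth_rule \<rho> k) (rule_input H \<rho> m) (Lst (H @ K)) \<and>
           items (result (nth_rule \<rho> k) (rule_input H \<rho> m)) = H @ K"
    by auto
qed

lemma recursive_bijection_pos:
  assumes "recursive_bijection f" "i > 0"
  shows "fst (f i) > 0" "snd (f i) > 0"
proof -
  have "f i \<in> {0<..} \<times> {0<..}"
    using assms bij_betwE unfolding recursive_bijection_def by fastforce
  then show "fst (f i) > 0" "snd (f i) > 0" by (cases "f i"; simp)+
qed

lemma deduction_list_step:
  assumes "recursive_bijection f" "library \<rho>" "set \<Gamma> \<subseteq> Stmts"
  shows "set (deduction_list f \<rho> \<Gamma> i) \<subseteq> Stmts"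
    and "halts (nth_rule \<rho> (fst (f (Suc i))))
           (rule_input (deduction_list f \<rho> \<Gamma> i) \<rho> (snd (f (Suc i))))
           (Lst (deduction_list f \<rho> \<Gamma> (Suc i)))"
proof -
  note pos = recursive_bijection_pos[OF assms(1) zero_less_Suc]
  show *: "set (deduction_list f \<rho> \<Gamma> i) \<subseteq> Stmts" for i
  proof (induction i)
    case (Suc i)
    from library_step(2)[OF assms(2) pos[of i] Suc.IH] Suc.IH show ?case
      by (auto simp: case_prod_beta)
  qed (use assms in simp)
  from library_step(2)[OF assms(2) pos[of i] *[of i]]
  show "halts (nth_rule \<rho> (fst (f (Suc i))))
           (rule_input (deduction_list f \<rho> \<Gamma> i) \<rho> (snd (f (Suc i))))
           (Lst (deduction_list f \<rho> \<Gamma> (Suc i)))"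
    by (auto simp: case_prod_beta)
qed

lemma decidable_member:
  assumes "computable f" "computable g"
  shows "decidable (\<lambda>u. f u \<in> set (items (g u)))"
proof -
  let ?h = "prim_fun Head" and ?t = "prim_fun Tail"
  define G where "G w = (if ?h w = ?h (?t (?t w)) then Num 1 else ?h (?t w))" for w
  have "computable G" unfolding G_def by (intro computable_intros)
  from computable_fold[OF this assms(2) computable_const[of "Num 0"] assms(1)]
  have "computable (\<lambda>u. fold (\<lambda>x acc. G (Lst [x, acc, f u])) (items (g u)) (Num 0))" .
  moreover have "fold (\<lambda>x acc. G (Lst [x, acc, y])) xs a = (if y \<in> set xs then Num 1 else a)" for y xs a
    by (induction xs arbitrary: a) (auto simp: G_def)
  ultimately have "computable (\<lambda>u. if f u \<in> set (items (g u)) then Num 1 else Num 0)" by simp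
  then show ?thesis by (simp add: decidable_def of_bool_def if_distrib cong: if_cong)
qed

lemma exists_implements_deduce:
  assumes f: "recursive_bijection f"
  shows "\<exists>deduce. implements_deduce f deduce"
proof -
  let ?h = "prim_fun Head" and ?t = "prim_fun Tail"
  obtain fa where fa: "\<And>i. i > 0 \<Longrightarrow> halts fa (Num i) (Lst [Num (fst (f i)), Num (snd (f i))])"
    using f unfolding recursive_bijection_def by blast
  txt \<open>The state of the loop is \<open>[H\<^sub>i, \<rho>, B, i + 1]\<close>.\<close>
  have "computable (\<lambda>w. ?h (?t (?t (?t w))))" by (intro computable_intros)
  then obtain geti where geti: "\<And>w v. halts geti w v \<longleftrightarrow> v = ?h (?t (?t (?t w)))"
    by (rule computable_alg) blast
  have "computable (\<lambda>w. w)" by (rule computable_id)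
  then obtain idn where idn: "\<And>w v. halts idn w v \<longleftrightarrow> v = w"
    by (rule computable_alg) blast
  txt \<open>Extend the state by the pair \<open>f (i + 1)\<close>, then run the rule.\<close>
  define ext where "ext = Prepend (Comp fa geti) idn"
  have "computable (\<lambda>w. Lst [?h (?t (?t w)), ?h (?h w)])" by (intro computable_intros)
  then obtain r1 where r1: "\<And>w v. halts r1 w v \<longleftrightarrow> v = Lst [?h (?t (?t w)), ?h (?h w)]"
    by (rule computable_alg) blast
  have "computable (\<lambda>w. Lst [Lst [?h (?t w), ?h (?t (?t w)), ?h (?t (?h w))]])"
    by (intro computable_intros)
  then obtain r2 where
    r2: "\<And>w v. halts r2 w v \<longleftrightarrow> v = Lst [Lst [?h (?t w), ?h (?t (?t w)), ?h (?t (?h w))]]"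
    by (rule computable_alg) blast
  have "computable (\<lambda>w. Lst [?h (?t (?t w)), ?h (?t (?t (?t w))),
      prim_fun Succ (?h (?t (?t (?t (?t w)))))])"
    by (intro computable_intros)
  then obtain r3 where r3: "\<And>w v. halts r3 w v \<longleftrightarrow> v = Lst [?h (?t (?t w)), ?h (?t (?t (?t w))),
      prim_fun Succ (?h (?t (?t (?t (?t w)))))]"
    by (rule computable_alg) blast
  define b where "b = Comp (Prepend (Comp Run (Prepend (Comp Run r1) r2)) r3) ext"
  have "decidable (\<lambda>w. \<not> ?h (?t (?t w)) \<in> set (items (?h w)))"
    by (intro computable_intros decidable_member)
  then obtain c where c: "\<And>w v. halts c w v \<longleftrightarrow>
      v = Num (of_bool (\<not> ?h (?t (?t w)) \<in> set (items (?h w))))"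
    unfolding decidable_def by (rule computable_alg) blast
  have "computable (\<lambda>w. Lst [?h w, ?h (?t w), ?h (?t (?t w)), Num 1])" by (intro computable_intros)
  then obtain ini where ini: "\<And>w v. halts ini w v \<longleftrightarrow>
      v = Lst [?h w, ?h (?t w), ?h (?t (?t w)), Num 1]"
    by (rule computable_alg) blast
  define deduce where "deduce = Comp (Const (Num 1)) (Comp (While c b) (Comp b ini))"
  have "if \<exists>i>0. B \<in> set (deduction_list f \<rho> \<Gamma> i)
        then halts deduce (Lst [Lst \<Gamma>, Alg \<rho>, B]) (Num 1)
        else \<nexists>v. halts deduce (Lst [Lst \<Gamma>, Alg \<rho>, B]) v"
    if h: "set \<Gamma> \<subseteq> Stmts" "library \<rho>" "B \<in> Stmts" for \<Gamma> \<rho> B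
  proof -
    let ?H = "deduction_list f \<rho> \<Gamma>"
    define S where "S i = Lst [Lst (?H i), Alg \<rho>, B, Num (Suc i)]" for i
    note step = deduction_list_step[OF f h(2,1)]
    have b: "halts b (S i) (S (Suc i))" for i
    proof -
      let ?k = "fst (f (Suc i))" and ?m = "snd (f (Suc i))"
      let ?E = "Lst [Lst [Num ?k, Num ?m], Lst (?H i), Alg \<rho>, B, Num (Suc i)]"
      have "halts ext (S i) ?E"
        unfolding ext_def halts_Prepend halts_Comp geti idn
        using fa[of "Suc i"] by (auto simp: S_def)
      moreover have "halts (Comp Run r1) ?E (Alg (nth_rule \<rho> ?k))"
        using library_step(1)[OF h(2) recursive_bijection_pos[OF f, of "Suc i"] h(1)]
        by (auto simp: halts_Comp r1 halts_Run)
      then have "halts (Prepend (Comp Run r1) r2) ?E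
          (Lst [Alg (nth_rule \<rho> ?k), rule_input (?H i) \<rho> ?m])"
        unfolding halts_Prepend r2 by (auto simp: rule_input_def)
      with step(2)[of i] have "halts (Comp Run (Prepend (Comp Run r1) r2)) ?E (Lst (?H (Suc i)))"
        by (auto simp: halts_Comp halts_Run simp del: deduction_list.simps)
      then have "halts (Prepend (Comp Run (Prepend (Comp Run r1) r2)) r3) ?E (S (Suc i))"
        unfolding halts_Prepend r3 by (auto simp: S_def simp del: deduction_list.simps)
      ultimately show ?thesis unfolding b_def by (subst halts_Comp) blast
    qed
    have c': "halts c (S (Suc i)) (Num (of_bool (B \<notin> set (?H (Suc i)))))" for i
      by (simp add: c S_def del: deduction_list.simps)
    have W: "halts (While c b) (S (Suc 0)) w \<longleftrightarrow>
        (\<exists>k. w = S (Suc k) \<and> \<not> B \<notin> set (?H (Suc k)) \<and> (\<forall>j<k. B \<notin> set (?H (Suc j))))" for w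
      by (rule halts_While_sequence[where S = "\<lambda>i. S (Suc i)"]) (rule b c')+
    have I: "halts (Comp b ini) (Lst [Lst \<Gamma>, Alg \<rho>, B]) x \<longleftrightarrow> x = S (Suc 0)" for x
      using b[of 0] halts_unique by (auto simp: halts_Comp ini S_def simp del: deduction_list.simps(2))
    have D: "halts deduce (Lst [Lst \<Gamma>, Alg \<rho>, B]) v \<longleftrightarrow> v = Num 1 \<and>
        (\<exists>k. B \<in> set (?H (Suc k)) \<and> (\<forall>j<k. B \<notin> set (?H (Suc j))))" for v
      by (auto simp: deduce_def halts_Comp[of "Const _"] halts_Comp[of "While _ _"] I W halts_Const
          simp del: deduction_list.simps)
    have least: "(\<exists>k. B \<in> set (?H (Suc k)) \<and> (\<forall>j<k. B \<notin> set (?H (Suc j)))) \<longleftrightarrow>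
        (\<exists>i>0. B \<in> set (?H i))"
      using exists_least_iff[of "\<lambda>k. B \<in> set (?H (Suc k))"] gr0_conv_Suc by metis
    show ?thesis unfolding D least by simp
  qed
  then show ?thesis unfolding implements_deduce_def by blast
qed

lemma exists_recursive_bijection: "\<exists>f. recursive_bijection f"
proof -
  let ?h = "prim_fun Head" and ?t = "prim_fun Tail"
  define g where "g p = (case p of (a, b) \<Rightarrow> (Suc a, Suc b))" for p :: "nat \<times> nat"
  define f where "f i = g (prod_decode (i - 1))" for i
  have "bij_betw (\<lambda>i. i - 1) {0<..} (UNIV :: nat set)"
    by (rule bij_betw_byWitness[where f' = Suc]) auto
  moreover have "bij_betw g UNIV ({0<..} \<times> {0<..})"
    by (rule bij_betw_byWitness[where f' = "\<lambda>(a, b). (a - 1, b - 1)"]) (auto simp: g_def)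
  ultimately have "bij_betw (g \<circ> (prod_decode \<circ> (\<lambda>i. i - 1))) {0<..} ({0<..} \<times> {0<..})"
    by (intro bij_betw_trans[OF bij_betw_trans[OF _ bij_prod_decode]])
  then have bij: "bij_betw f {0<..} ({0<..} \<times> {0<..})"
    by (rule back_subst[of "\<lambda>f. bij_betw f _ _"]) (simp add: f_def fun_eq_iff)
  define nx where "nx w = (if ?h (?t w) = Num 1 then Lst [Num 1, prim_fun Succ (?h w)]
      else Lst [prim_fun Succ (?h w), prim_fun Pred (?h (?t w))])" for w
  have "computable nx" unfolding nx_def by (intro computable_intros)
  moreover define k where "k u = (case u of Num n \<Rightarrow> n - 1 | _ \<Rightarrow> 0)" for u
  have "computable (\<lambda>u. prim_fun Pred u)" by (intro computable_intros)
  then have "computable (\<lambda>u. Num (k u))"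
    by (rule back_subst[of computable]) (auto simp: k_def fun_eq_iff split: datum.splits)
  ultimately have "computable (\<lambda>u. (nx ^^ k u) (Lst [Num 1, Num 1]))"
    by (intro computable_iterate computable_const)
  then obtain a where a: "\<And>u v. halts a u v \<longleftrightarrow> v = (nx ^^ k u) (Lst [Num 1, Num 1])"
    by (rule computable_alg) blast
  have nxt: "prod_decode (Suc n) = (case prod_decode n of (a, b) \<Rightarrow>
      if b = 0 then (0, Suc a) else (Suc a, b - 1))" for n
  proof -
    obtain a b where ab: "prod_decode n = (a, b)" by fastforce
    then have n: "n = prod_encode (a, b)" by (metis prod_decode_inverse)
    have "Suc n = prod_encode (if b = 0 then (0, Suc a) else (Suc a, b - 1))"
      unfolding n by (cases b) (auto simp: prod_encode_def)
    then show ?thesis by (simp add: ab)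
  qed
  have "(nx ^^ n) (Lst [Num 1, Num 1]) = Lst [Num (fst (f (Suc n))), Num (snd (f (Suc n)))]" for n
  proof (induction n)
    case 0
    have "prod_decode 0 = (0, 0)" by (simp add: prod_decode_def prod_decode_aux.simps)
    then show ?case by (simp add: f_def g_def)
  next
    case (Suc n)
    obtain a b where ab: "prod_decode n = (a, b)" by fastforce
    from Suc show ?case by (simp add: f_def g_def nxt ab nx_def)
  qed
  then have "halts a (Num i) (Lst [Num (fst (f i)), Num (snd (f i))])" if "i > 0" for i
    using that by (cases i) (simp_all add: a k_def)
  with bij show ?thesis unfolding recursive_bijection_def by blast
qed

lemma computable_funpow: "computable s \<Longrightarrow> computable (s ^^ n)"
proof (induction n)
  case 0
  then show ?case using computable_id by (simp add: id_def)
next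
  case (Suc n)
  then show ?case using computable_comp[of s "s ^^ n"] by (simp add: comp_def)
qed

lemma exists_implements_premise_free:
  assumes Y: "computable (\<lambda>w. Y (prim_fun Head w) (prim_fun Head (prim_fun Tail w)))"
    and size: "\<And>\<rho> A. dsize A \<le> dsize (Y \<rho> A)"
  shows "\<exists>r. implements_premise_free Y r"
proof -
  let ?h = "prim_fun Head" and ?t = "prim_fun Tail"
  txt \<open>Enumerate all data by iterating the constructors.\<close>
  define G1 where "G1 w = Lst (Lst (?h (?t (?t w)) # items (?h w)) # items (?h (?t w)))" for w
  define G2 where "G2 w = fold (\<lambda>l acc. G1 (Lst [l, acc, ?h w])) (items (?h (?t (?t w))))
    (Lst (prim_fun Succ (?h w) # items (Lst (prim_fun Reify (?h w) # items (?h (?t w))))))" for w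
  define stp where "stp D = fold (\<lambda>x acc. G2 (Lst [x, acc, D])) (items D) D" for D
  have "computable G1" unfolding G1_def by (intro computable_intros)
  then have "computable G2" unfolding G2_def by (intro computable_fold computable_intros)
  then have stp: "computable stp" unfolding stp_def by (intro computable_fold computable_id)
  have inner: "set (items (fold (\<lambda>l acc. G1 (Lst [l, acc, x])) ls a)) =
      set (items a) \<union> (\<lambda>l. Lst (x # items l)) ` set ls" for x ls a
    by (induction ls arbitrary: a) (auto simp: G1_def)
  have G2: "set (items (G2 (Lst [x, a, D]))) = {prim_fun Succ x, prim_fun Reify x} \<union>
      set (items a) \<union> (\<lambda>l. Lst (x # items l)) ` set (items D)" for x a D
    unfolding G2_def inner by auto
  have outer: "set (items (fold (\<lambda>x acc. G2 (Lst [x, acc, D])) xs a)) = set (items a) \<union>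
      (\<Union>x\<in>set xs. {prim_fun Succ x, prim_fun Reify x} \<union>
        (\<lambda>l. Lst (x # items l)) ` set (items D))" for D xs a
    by (induction xs arbitrary: a) (auto simp: G2 simp del: prim_fun.simps)
  define E where "E n = set (items ((stp ^^ n) (Lst [Num 0, Lst []])))" for n
  have E_Suc: "E (Suc n) = E n \<union> (\<Union>x\<in>E n. {prim_fun Succ x, prim_fun Reify x} \<union>
      (\<lambda>l. Lst (x # items l)) ` E n)" for n
    by (simp add: E_def stp_def outer del: prim_fun.simps)
  have E_mono: "x \<in> E m" if "x \<in> E n" "n \<le> m" for x n m
    using that(2,1) by (induction rule: dec_induct) (auto simp: E_Suc simp del: prim_fun.simps)
  have E_0: "Num 0 \<in> E n" "Lst [] \<in> E n" for n
    using E_mono[of _ 0 n] by (auto simp: E_def)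
  have E_Cons: "Lst (x # xs) \<in> E (Suc n)" if "x \<in> E n" "Lst xs \<in> E n" for x xs n
    using that by (force simp: E_Suc simp del: prim_fun.simps)
  have E_Num: "Num k \<in> E n" if "k \<le> n" for k n
  proof -
    have "Num k \<in> E k"
    proof (induction k)
      case (Suc k)
      then have "prim_fun Succ (Num k) \<in> E (Suc k)" unfolding E_Suc by blast
      then show ?case by simp
    qed (rule E_0)
    then show ?thesis using that E_mono by blast
  qed
  have E_Lst: "Lst xs \<in> E (n + length xs)" if "set xs \<subseteq> E n" for xs n
    using that
  proof (induction xs)
    case (Cons x xs)
    then show ?case using E_Cons[of x "n + length xs" xs] E_mono[of x n "n + length xs"] by simp
  qed (simp add: E_0)
  have E_Alg: "Alg a \<in> E n" if "set (items (reflect a)) \<subseteq> E k" "k + 5 \<le> n" for a k n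
  proof -
    have "Lst (items (reflect a)) \<in> E (k + length (items (reflect a)))"
      using E_Lst that(1) .
    moreover have "length (items (reflect a)) \<le> 4" "Lst (items (reflect a)) = reflect a"
      by (cases a; simp)+
    ultimately have "reflect a \<in> E (k + 4)" using E_mono by simp
    then have "prim_fun Reify (reflect a) \<in> E (Suc (k + 4))" unfolding E_Suc by blast
    then have "Alg a \<in> E (Suc (k + 4))" by (simp add: inv_f_f[OF inj_reflect])
    then show ?thesis using E_mono that(2) by (simp add: add.commute)
  qed
  have E_all: "d \<in> E (20 * dsize d)" for d
  proof (induction "dsize d" arbitrary: d rule: less_induct)
    case less
    have IH: "d' \<in> E n" if "dsize d' < dsize d" "20 * dsize d' \<le> n" for d' n
      using less[OF that(1)] E_mono that(2) by blast
    show ?case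
    proof (cases d)
      case (Num n)
      then show ?thesis using E_Num by simp
    next
      case (Lst xs)
      show ?thesis
      proof (cases xs)
        case (Cons y ys)
        have "dsize y > 0" by (rule dsize_pos)
        then have "y \<in> E (20 * dsize d - 1)" "Lst ys \<in> E (20 * dsize d - 1)"
          by (auto intro!: IH simp: Lst Cons)
        from E_Cons[OF this] show ?thesis by (simp add: Lst Cons)
      qed (simp add: Lst E_0)
    next
      case (Alg a)
      have pc: "prim_code p \<le> 10" for p by (cases p) simp_all
      have "set (items (reflect a)) \<subseteq> E (20 * asize a)"
        by (cases a) (auto intro!: IH E_Num le_trans[OF pc] simp: Alg)
      then have "Alg a \<in> E (20 * dsize d)" by (rule E_Alg) (simp add: Alg)
      then show ?thesis by (simp add: Alg)
    qed
  qed
  define D where "D m = (stp ^^ (20 * m)) (Lst [Num 0, Lst []])" for m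
  have D: "A \<in> set (items (D m))" if "dsize A \<le> m" for A m
    using E_mono[OF E_all[of A], of "20 * m"] that by (simp add: D_def E_def)
  txt \<open>The input is \<open>u = [H, \<rho>, m]\<close>.\<close>
  define k where "k u = (case ?h (?t (?t u)) of Num n \<Rightarrow> n | _ \<Rightarrow> 0)" for u
  have "computable (\<lambda>u. prim_fun Pred (prim_fun Succ (?h (?t (?t u)))))"
    by (intro computable_intros)
  then have "computable (\<lambda>u. Num (k u))"
    by (rule back_subst[of computable]) (auto simp: k_def fun_eq_iff split: datum.splits)
  then have "computable (\<lambda>u. ((stp ^^ 20) ^^ k u) (Lst [Num 0, Lst []]))"
    by (intro computable_iterate computable_funpow stp computable_const)
  then have cD: "computable (\<lambda>u. D (k u))"
    by (simp add: funpow_mult D_def mult.commute)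
  define isS where "isS A \<longleftrightarrow> prim_fun Kind A = Num 2 \<and> prim_fun Kind (?h A) = Num 1 \<and>
    ?t (?t (?t A)) = Lst [] \<and> \<not> ?t (?t A) = Lst []" for A
  have isS: "isS A \<longleftrightarrow> A \<in> Stmts" for A
  proof
    assume "isS A"
    then obtain xs where A: "A = Lst xs" by (cases A) (auto simp: isS_def)
    with \<open>isS A\<close> obtain x where "xs = x # tl xs" "prim_fun Kind x = Num 1"
      by (cases xs) (auto simp: isS_def)
    moreover then obtain a where "x = Alg a" by (cases x) auto
    moreover have "tl (tl (tl xs)) = []" "tl (tl xs) \<noteq> []"
      using \<open>isS A\<close> by (auto simp: isS_def A)
    then obtain u v where "tl xs = [u, v]" by (cases "tl xs"; cases "tl (tl xs)") auto
    ultimately have "A = stmt a u v" by (simp add: A stmt_def)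
    then show "A \<in> Stmts" by (auto simp: Stmts_def)
  qed (auto simp: Stmts_def stmt_def isS_def)
  have disS: "decidable (\<lambda>w. isS (f w))" if "computable f" for f
    unfolding isS_def by (intro computable_intros that)
  define G3 where "G3 w = (if isS (?h w) \<and>
      prim_fun Leq (Lst [prim_fun Size (Y (?h (?h (?t (?t w)))) (?h w)), ?h (?t (?h (?t (?t w))))]) = Num 1
    then Lst (Y (?h (?h (?t (?t w)))) (?h w) # items (?h (?t w))) else ?h (?t w))" for w
  have cY: "computable (\<lambda>w. Y (f w) (g w))" if "computable f" "computable g" for f g
  proof -
    have "computable (\<lambda>w. Lst [f w, g w])" by (intro computable_intros that)
    from computable_comp[OF Y this] show ?thesis by simp
  qed
  have cG3: "computable G3"
    unfolding G3_def by (intro computable_intros cY disS)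
  define K where "K u = fold (\<lambda>x acc. G3 (Lst [x, acc, Lst [?h (?t u), ?h (?t (?t u))]]))
    (items (D (k u))) (Lst [])" for u
  have cK: "computable K"
    unfolding K_def by (intro computable_fold cG3 cD computable_intros)
  have G3: "fold (\<lambda>x acc. G3 (Lst [x, acc, Lst [\<rho>, Num m]])) xs (Lst ys) =
      Lst (rev (map (Y \<rho>) (filter (\<lambda>A. A \<in> Stmts \<and> dsize (Y \<rho> A) \<le> m) xs)) @ ys)" for \<rho> m xs ys
    by (induction xs arbitrary: ys) (auto simp: G3_def isS)
  define G4 where "G4 w = Lst (?h w # items (?h (?t w)))" for w
  have cG4: "computable G4" unfolding G4_def by (intro computable_intros)
  have G4: "fold (\<lambda>x acc. G4 (Lst [x, acc, e])) xs (Lst ys) = Lst (rev xs @ ys)" for e xs ys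
    by (induction xs arbitrary: ys) (auto simp: G4_def)
  define rv where "rv u = fold (\<lambda>x acc. G4 (Lst [x, acc, Num 0])) (items (?h u)) (Lst [])" for u
  define out where "out u = fold (\<lambda>x acc. G4 (Lst [x, acc, Num 0])) (items (rv u)) (K u)" for u
  have "computable rv"
    unfolding rv_def by (intro computable_fold cG4 computable_intros)
  then have "computable out"
    unfolding out_def by (intro computable_fold cG4 cK computable_intros)
  then obtain r where r: "\<And>u v. halts r u v \<longleftrightarrow> v = out u"
    by (rule computable_alg) blast
  have "\<exists>K. halts r (rule_input H \<rho> m) (Lst (H @ K)) \<and>
      set K = {Y (Alg \<rho>) A |A. A \<in> Stmts \<and> dsize (Y (Alg \<rho>) A) \<le> m}" for H \<rho> m
  proof -
    define L where "L = rev (map (Y (Alg \<rho>))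
      (filter (\<lambda>A. A \<in> Stmts \<and> dsize (Y (Alg \<rho>) A) \<le> m) (items (D m))))"
    have "K (rule_input H \<rho> m) = Lst L"
      using G3[of "Alg \<rho>" m "items (D m)" "[]"] by (simp add: K_def k_def rule_input_def L_def)
    moreover have "rv (rule_input H \<rho> m) = Lst (rev H)"
      by (simp add: rv_def rule_input_def G4)
    ultimately have "out (rule_input H \<rho> m) = Lst (H @ L)"
      by (simp add: out_def G4)
    moreover have "set L = {Y (Alg \<rho>) A |A. A \<in> Stmts \<and> dsize (Y (Alg \<rho>) A) \<le> m}"
      using D le_trans[OF size] by (auto simp: L_def)
    ultimately show ?thesis unfolding r by auto
  qed
  then show ?thesis unfolding implements_premise_free_def by blast
qed

lemma exists_implements_P8: "\<exists>r. implements_P8 deduce or_alg r"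
  and exists_implements_P9: "\<exists>r. implements_P9 deduce or_alg r"
  unfolding implements_P8_def implements_P9_def
    disj_def neg_def implies_def entails_def stmt_def
  by (rule exists_implements_premise_free, (intro computable_intros)[], simp)+

lemma is_rule_premise_free:
  assumes r: "implements_premise_free Y r" and Y: "\<And>\<rho> A. Y \<rho> A \<in> Stmts"
  shows "is_rule r"
proof -
  have out: "\<exists>K. halts r (rule_input H \<rho> m) (Lst (H @ K)) \<and>
      set K = {Y (Alg \<rho>) A |A. A \<in> Stmts \<and> dsize (Y (Alg \<rho>) A) \<le> m}"
    if "set H \<subseteq> Stmts" "algorithmic_sequence \<rho>" "m > 0" for H \<rho> m
    using r that unfolding implements_premise_free_def by blast
  have "set L \<subseteq> set L'"
    if h: "set H \<subseteq> Stmts" "set H' \<subseteq> Stmts" "algorithmic_sequence \<rho>" "m > 0" "m' \<ge> m"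
      "set H \<subseteq> set H'" "halts r (rule_input H \<rho> m) (Lst L)" "halts r (rule_input H' \<rho> m') (Lst L')"
    for H H' \<rho> m m' L L'
  proof -
    have "m' > 0" using h(4,5) by simp
    obtain K K' where KK: "halts r (rule_input H \<rho> m) (Lst (H @ K))"
      "halts r (rule_input H' \<rho> m') (Lst (H' @ K'))"
      and K: "set K = {Y (Alg \<rho>) A |A. A \<in> Stmts \<and> dsize (Y (Alg \<rho>) A) \<le> m}"
      "set K' = {Y (Alg \<rho>) A |A. A \<in> Stmts \<and> dsize (Y (Alg \<rho>) A) \<le> m'}"
      using out[OF h(1,3,4)] out[OF h(2,3) \<open>m' > 0\<close>] by blast
    have "L = H @ K" "L' = H' @ K'"
      using halts_unique[OF h(7) KK(1)] halts_unique[OF h(8) KK(2)] by simp_all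
    moreover have "set K \<subseteq> set K'" unfolding K using h(5) by fastforce
    ultimately show ?thesis using h(6) by auto
  qed
  moreover have "\<exists>K. set K \<subseteq> Stmts \<and> halts r (rule_input H \<rho> m) (Lst (H @ K))"
    if h: "set H \<subseteq> Stmts" "algorithmic_sequence \<rho>" "m > 0" for H \<rho> m
  proof -
    obtain K where "halts r (rule_input H \<rho> m) (Lst (H @ K))"
      "set K = {Y (Alg \<rho>) A |A. A \<in> Stmts \<and> dsize (Y (Alg \<rho>) A) \<le> m}"
      using out[OF h] by blast
    with Y show ?thesis by (intro exI[of _ K]) auto
  qed
  ultimately show ?thesis unfolding is_rule_def by blast
qed

lemma is_rule_P8: "implements_P8 deduce or_alg r \<Longrightarrow> is_rule r"
  and is_rule_P9: "implements_P9 deduce or_alg r \<Longrightarrow> is_rule r"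
  unfolding implements_P8_def implements_P9_def
  by (erule is_rule_premise_free; auto simp: disj_def Stmts_def)+

end

theory Submission
  imports Defs
begin

text \<open>For a library \<open>\<rho>\<close>, let \<open>Q\<close> assert that a search for computations verifying \<open>\<not>\<^sub>\<rho> Q\<close> or
  \<open>\<not>\<^sub>\<rho> \<not>\<^sub>\<rho> Q\<close> verifies \<open>\<not>\<^sub>\<rho> Q\<close> first, and adjoin to the base the rule that infers \<open>\<F>\<close> from \<open>Q\<close> as
  soon as \<open>\<not>\<^sub>\<rho> \<not>\<^sub>\<rho> Q\<close> has been verified first. This rule is valid because then \<open>Q\<close> is false; hence,
  the base being stable, the whole library is valid. If \<open>\<not>\<^sub>\<rho> Q\<close> is verified first, then \<open>Q\<close> is true
  and entails \<open>\<F>\<close>. If \<open>\<not>\<^sub>\<rho> \<not>\<^sub>\<rho> Q\<close> is verified first, then the new rule makes \<open>\<not>\<^sub>\<rho> Q\<close> true, while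
  \<open>\<not>\<^sub>\<rho> Q\<close> entails \<open>\<F>\<close>. Both contradict validity, so the search does not end, and \<open>Q\<close>, \<open>\<not>\<^sub>\<rho> Q\<close> and
  \<open>\<not>\<^sub>\<rho> \<not>\<^sub>\<rho> Q\<close> are all false. Since a rule receives the library as an input, only \<open>Q\<close> is
  self-referential, not \<open>\<rho>\<close>.\<close>

section \<open>Clocked runs and the race between two statements\<close>

text \<open>The function that \<open>Sim\<close> computes, named so that timed runs can occur inside
  computable functions. \<open>Lst []\<close> stands for a timeout or an ill-formed input; an output
  comes wrapped in a one-item list, so the two cannot be confused.\<close>

definition sim :: "datum \<Rightarrow> datum" where
  "sim u = (case items u of
      [Alg a, v, Num t] \<Rightarrow> (case exec t a v of None \<Rightarrow> Lst [] | Some (w, r) \<Rightarrow> Lst [w])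
    | _ \<Rightarrow> Lst [])"

lemma computable_sim:
  assumes "computable f"
  shows "computable (\<lambda>u. sim (f u))"
proof (rule computable_comp[OF _ assms])
  show "computable sim"
    unfolding computable_def sim_def by (rule exI[of _ Sim]) (simp add: halts_Sim)
qed

lemma sim_eq_iff: "sim (Lst [Alg a, v, Num t]) = Lst [w] \<longleftrightarrow> (\<exists>r. exec t a v = Some (w, r))"
  by (auto simp: sim_def split: option.splits)

text \<open>Extra time does not change an output already reached. This makes the diagonal rule
  monotone in its resource integer.\<close>

lemma sim_mono:
  assumes "sim (Lst [Alg a, v, Num t]) = Lst [w]" "t \<le> t'"
  shows "sim (Lst [Alg a, v, Num t']) = Lst [w]"
  using assms exec_add[of t a v w _ "t' - t"] by (auto simp: sim_eq_iff)

lemma halts_iff_sim: "halts a v w \<longleftrightarrow> (\<exists>t. sim (Lst [Alg a, v, Num t]) = Lst [w])"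
  by (simp add: halts_def sim_eq_iff)

text \<open>Folding with a prepending step reverses a list. The first list is therefore reversed
  beforehand and then folded onto the second.\<close>

lemma computable_append:
  assumes f: "computable f" and g: "computable g"
  shows "computable (\<lambda>u. Lst (items (f u) @ items (g u)))"
proof -
  let ?h = "prim_fun Head" and ?t = "prim_fun Tail"
  define G where "G w = Lst (?h w # items (?h (?t w)))" for w
  have G: "computable G" unfolding G_def by (intro computable_intros)
  have fold_G: "fold (\<lambda>x acc. G (Lst [x, acc, e])) xs (Lst ys) = Lst (rev xs @ ys)" for e xs ys
    by (induction xs arbitrary: ys) (auto simp: G_def)
  define rv where "rv u = fold (\<lambda>x acc. G (Lst [x, acc, Num 0])) (items (f u)) (Lst [])" for u
  have "computable rv"
    unfolding rv_def by (intro computable_fold G f computable_const)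
  \<comment> \<open>Prepending a dummy and taking the tail gives \<open>Lst (items (g u))\<close>,
    also when \<open>g u\<close> is not a list.\<close>
  moreover have "computable (\<lambda>u. ?t (Lst (Num 0 # items (g u))))"
    by (intro computable_intros g)
  ultimately have "computable (\<lambda>u. fold (\<lambda>x acc. G (Lst [x, acc, Num 0])) (items (rv u))
      (?t (Lst (Num 0 # items (g u)))))"
    by (intro computable_fold G computable_const)
  then show ?thesis by (simp add: rv_def fold_G)
qed

text \<open>Both statements are tested under a common time bound, which grows by one until some test
  succeeds. Bounding the time keeps a diverging statement from blocking the other one.\<close>

lemma exists_race:
  obtains race where
    "\<And>A B v. A \<in> Stmts \<Longrightarrow> B \<in> Stmts \<Longrightarrow> halts race (Lst [A, B]) v \<Longrightarrow>
       v = Num 0 \<and> true_stmt B \<or> v = Num 1 \<and> true_stmt A"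
    "\<And>A B. A \<in> Stmts \<Longrightarrow> B \<in> Stmts \<Longrightarrow> true_stmt A \<or> true_stmt B \<Longrightarrow>
       \<exists>v. halts race (Lst [A, B]) v"
proof -
  let ?h = "prim_fun Head" and ?t = "prim_fun Tail"
  \<comment> \<open>\<open>A\<close> is verified within time \<open>t\<close>: a timed run of its
    algorithm on its input gives its claimed output.\<close>
  define T where "T A t \<longleftrightarrow> sim (Lst [?h A, ?h (?t A), t]) = Lst [?h (?t (?t A))]" for A t
  have dT: "decidable (\<lambda>u. T (A u) (t u))" if "computable A" "computable t" for A t
    unfolding T_def by (intro computable_intros computable_sim that)
  have T: "true_stmt A \<longleftrightarrow> (\<exists>t. T A (Num t))" if "A \<in> Stmts" for A
    using that by (auto simp: Stmts_def true_stmt_def T_def stmt_def halts_iff_sim)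
  define P where "P w \<longleftrightarrow> \<not> (T (?h w) (?h (?t (?t w))) \<or> T (?h (?t w)) (?h (?t (?t w))))" for w
  have "decidable P"
    unfolding P_def by (intro computable_intros dT)
  then obtain c where c: "\<And>u v. halts c u v \<longleftrightarrow> v = Num (of_bool (P u))"
    unfolding decidable_def by (rule computable_alg) blast
  have "computable (\<lambda>w. Lst [?h w, ?h (?t w), prim_fun Succ (?h (?t (?t w)))])"
    by (intro computable_intros)
  then obtain b where
    b: "\<And>w v. halts b w v \<longleftrightarrow> v = Lst [?h w, ?h (?t w), prim_fun Succ (?h (?t (?t w)))]"
    by (rule computable_alg) blast
  have "computable (\<lambda>w. Lst [?h w, ?h (?t w), Num 0])"
    by (intro computable_intros)
  then obtain i where i: "\<And>w v. halts i w v \<longleftrightarrow> v = Lst [?h w, ?h (?t w), Num 0]"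
    by (rule computable_alg) blast
  \<comment> \<open>A tie is settled in favour of the second statement; the output only has to point
    to a true one.\<close>
  have "computable (\<lambda>w. if T (?h (?t w)) (?h (?t (?t w))) then Num 0 else Num 1)"
    by (intro computable_intros dT)
  then obtain e where e: "\<And>w v. halts e w v \<longleftrightarrow>
      v = (if T (?h (?t w)) (?h (?t (?t w))) then Num 0 else Num 1)"
    by (rule computable_alg) blast
  define race where "race = Comp e (Comp (While c b) i)"
  have halts: "halts race (Lst [A, B]) v \<longleftrightarrow>
      (\<exists>k. (T A (Num k) \<or> T B (Num k)) \<and> (\<forall>j<k. \<not> (T A (Num j) \<or> T B (Num j))) \<and>
        v = (if T B (Num k) then Num 0 else Num 1))" for A B v
  proof -
    define S where "S k = Lst [A, B, Num k]" for k
    have "halts (While c b) (S 0) w \<longleftrightarrow> (\<exists>k. w = S k \<and> \<not> P (S k) \<and> (\<forall>j<k. P (S j)))" for w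
      by (rule halts_While_sequence) (simp_all add: b c S_def)
    then show ?thesis by (auto simp: race_def halts_Comp i e S_def P_def)
  qed
  show ?thesis
  proof
    show "v = Num 0 \<and> true_stmt B \<or> v = Num 1 \<and> true_stmt A"
      if "A \<in> Stmts" "B \<in> Stmts" "halts race (Lst [A, B]) v" for A B v
      using that unfolding halts by (auto simp: T split: if_splits)
    show "\<exists>v. halts race (Lst [A, B]) v"
      if "A \<in> Stmts" "B \<in> Stmts" "true_stmt A \<or> true_stmt B" for A B
    proof -
      have "\<exists>k. T A (Num k) \<or> T B (Num k)" using that T by blast
      then have "\<exists>k. (T A (Num k) \<or> T B (Num k)) \<and> (\<forall>j<k. \<not> (T A (Num j) \<or> T B (Num j)))"
        by (subst (asm) exists_least_iff)
      then show ?thesis unfolding halts by blast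
    qed
  qed
qed

section \<open>Truth of disjunctions and negations; soundness of deduction\<close>

lemma true_stmt_stmt [simp]: "true_stmt (stmt a u v) \<longleftrightarrow> halts a u v"
  by (auto simp: true_stmt_def stmt_def)

lemma stmt_in_Stmts [simp]: "stmt a u v \<in> Stmts"
  by (auto simp: Stmts_def)

lemma falsum_in_Stmts [simp]: "falsum \<in> Stmts"
  and not_true_falsum [simp]: "\<not> true_stmt falsum"
  by (simp_all add: falsum_def halts_Prim)

lemma neg_in_Stmts [simp]: "neg deduce \<rho> A \<in> Stmts"
  by (simp add: neg_def implies_def entails_def)

lemma true_disj_iff:
  assumes "implements_or or_alg" "A \<in> Stmts" "B \<in> Stmts"
  shows "true_stmt (disj or_alg A B) \<longleftrightarrow> true_stmt A \<or> true_stmt B"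
proof -
  have "if true_stmt A \<or> true_stmt B then halts or_alg (Lst [A, B]) (Num 1)
        else if directly_false A \<and> directly_false B then halts or_alg (Lst [A, B]) (Num 0)
        else \<nexists>v. halts or_alg (Lst [A, B]) v"
    using assms unfolding implements_or_def by blast
  then show ?thesis
    using halts_unique[of or_alg "Lst [A, B]" "Num 0" "Num 1"]
    by (auto simp: disj_def split: if_splits)
qed

lemma true_neg_iff:
  assumes "implements_deduce f deduce" "library \<rho>" "A \<in> Stmts"
  shows "true_stmt (neg deduce (Alg \<rho>) A) \<longleftrightarrow> (\<exists>i>0. falsum \<in> set (deduction_list f \<rho> [A] i))"
proof -
  have "set [A] \<subseteq> Stmts" using assms(3) by simp
  then have "if \<exists>i>0. falsum \<in> set (deduction_list f \<rho> [A] i)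
     then halts deduce (Lst [Lst [A], Alg \<rho>, falsum]) (Num 1)
     else \<nexists>v. halts deduce (Lst [Lst [A], Alg \<rho>, falsum]) v"
    using assms(1,2) falsum_in_Stmts unfolding implements_deduce_def by blast
  then show ?thesis
    by (auto simp: neg_def implies_def entails_def split: if_splits)
qed

lemma algorithmic_sequence_library: "library \<rho> \<Longrightarrow> algorithmic_sequence \<rho>"
  unfolding library_def algorithmic_sequence_def by blast

text \<open>The output of a rule begins with its hypothesis list, so nothing is lost on the way. In
  \<open>true_neg_rule\<close> this keeps \<open>A\<close> available until the desired rule has its
  turn.\<close>

lemma deduction_list_mono:
  assumes "recursive_bijection f" "library \<rho>" "set \<Gamma> \<subseteq> Stmts"
  shows "set \<Gamma> \<subseteq> set (deduction_list f \<rho> \<Gamma> i)"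
proof (induction i)
  case (Suc i)
  note pos = recursive_bijection_pos[OF assms(1) zero_less_Suc, of i]
  from library_step(2)[OF assms(2) pos deduction_list_step(1)[OF assms, of i]] Suc.IH
  show ?case by (auto simp: case_prod_beta)
qed simp

lemma deduction_list_true:
  assumes f: "recursive_bijection f" and \<rho>: "valid_library \<rho>" and "\<forall>A\<in>set \<Gamma>. true_stmt A"
  shows "\<forall>A\<in>set (deduction_list f \<rho> \<Gamma> i). true_stmt A"
proof (induction i)
  case 0
  then show ?case using assms(3) by simp
next
  case (Suc i)
  have lib: "library \<rho>" using \<rho> by (simp add: valid_library_def)
  have \<Gamma>: "set \<Gamma> \<subseteq> Stmts" using assms(3) unfolding true_stmt_def Stmts_def by blast
  note pos = recursive_bijection_pos[OF f zero_less_Suc, of i]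
  have "nth_rule \<rho> (fst (f (Suc i))) \<in> rules_of \<rho>"
    using library_step(1)[OF lib pos(1) zero_less_one, of "[]"] pos unfolding rules_of_def by auto
  then have "rule_valid \<rho> (nth_rule \<rho> (fst (f (Suc i))))"
    using \<rho> by (simp add: valid_library_def)
  then show ?case
    using Suc.IH pos(2) deduction_list_step(2)[OF f lib \<Gamma>, of i] unfolding rule_valid_def by blast
qed

text \<open>Deduction with valid rules preserves truth, so it cannot lead from a true statement to
  \<open>falsum\<close>.\<close>

lemma neg_sound:
  assumes "recursive_bijection f" "implements_deduce f deduce" "valid_library \<rho>"
    and "true_stmt A" "true_stmt (neg deduce (Alg \<rho>) A)"
  shows False
proof -
  have "library \<rho>" "A \<in> Stmts"
    using assms(3,4) by (auto simp: valid_library_def true_stmt_def)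
  with assms(2,5) obtain i where "falsum \<in> set (deduction_list f \<rho> [A] i)"
    using true_neg_iff by blast
  then show False using deduction_list_true[OF assms(1,3), of "[A]" i] assms(4) by auto
qed

text \<open>The enumeration \<open>f\<close> reaches every pair of a rule index and a resource
  integer. Hence \<open>r\<close> is eventually applied with resource \<open>m\<close> to a list
  that still contains \<open>A\<close>.\<close>

lemma true_neg_rule:
  assumes f: "recursive_bijection f" and d: "implements_deduce f deduce" and lib: "library \<rho>"
    and A: "A \<in> Stmts" and r: "r \<in> rules_of \<rho>" and m: "m > 0"
    and out: "\<And>H. set H \<subseteq> Stmts \<Longrightarrow> A \<in> set H \<Longrightarrow>
      \<exists>L. halts r (rule_input H \<rho> m) (Lst L) \<and> falsum \<in> set L"
  shows "true_stmt (neg deduce (Alg \<rho>) A)"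
proof -
  from r obtain k where k: "k > 0" "halts \<rho> (Num k) (Alg r)" by (auto simp: rules_of_def)
  then have r_eq: "nth_rule \<rho> k = r"
    unfolding nth_rule_def using halts_unique by blast
  have "(k, m) \<in> f ` {0<..}"
    using f k(1) m unfolding recursive_bijection_def bij_betw_def by auto
  then obtain i where i: "f (Suc i) = (k, m)"
    by (metis greaterThan_iff gr0_conv_Suc imageE)
  have \<Gamma>: "set [A] \<subseteq> Stmts" using A by simp
  let ?H = "deduction_list f \<rho> [A]"
  have "A \<in> set (?H i)" using deduction_list_mono[OF f lib \<Gamma>, of i] by simp
  with out deduction_list_step(1)[OF f lib \<Gamma>] obtain L where
    L: "halts r (rule_input (?H i) \<rho> m) (Lst L)" "falsum \<in> set L" by blast
  have "halts r (rule_input (?H i) \<rho> m) (Lst (?H (Suc i)))"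
    using deduction_list_step(2)[OF f lib \<Gamma>, of i] by (simp add: i r_eq)
  with L(1) have "L = ?H (Suc i)" using halts_unique by blast
  with L(2) show ?thesis using true_neg_iff[OF d lib A] by blast
qed

section \<open>Adjoining a rule to a base\<close>

text \<open>\<open>r\<close> becomes the first term and the terms of \<open>\<sigma>\<close> move up
  by one index, which \<open>Pred\<close> undoes.\<close>

lemma exists_library_insert:
  assumes r: "is_rule r" and \<sigma>: "library \<sigma>"
  shows "\<exists>\<rho>. library \<rho> \<and> rules_of \<rho> = insert r (rules_of \<sigma>)"
proof -
  have "decidable (\<lambda>u. u = Num 1)" by (intro computable_intros)
  then obtain c where c: "\<And>u v. halts c u v \<longleftrightarrow> v = Num (of_bool (u = Num 1))"
    unfolding decidable_def by (rule computable_alg) blast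
  define \<rho> where "\<rho> = Cond c (Const (Alg r)) (Comp \<sigma> (Prim Pred))"
  have 1: "halts \<rho> (Num (Suc 0)) v \<longleftrightarrow> v = Alg r" for v
    by (simp add: \<rho>_def halts_Cond halts_Const c)
  have 2: "halts \<rho> (Num (Suc n)) v \<longleftrightarrow> halts \<sigma> (Num n) v" if "n > 0" for n v
    using that by (simp add: \<rho>_def halts_Cond halts_Comp halts_Prim c)
  have "\<exists>s. is_rule s \<and> halts \<rho> (Num n) (Alg s)" if "n > 0" for n
  proof (cases "n = 1")
    case False
    with that obtain k where "n = Suc k" "k > 0" by (cases n) auto
    then show ?thesis using \<sigma> 2 by (auto simp: library_def)
  qed (use r 1 in auto)
  then have "library \<rho>" unfolding library_def by blast
  moreover have "s \<in> rules_of \<rho> \<longleftrightarrow> s = r \<or> s \<in> rules_of \<sigma>" for s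
  proof -
    have "(\<exists>n>0. halts \<rho> (Num n) (Alg s)) \<longleftrightarrow>
        halts \<rho> (Num (Suc 0)) (Alg s) \<or> (\<exists>n>0. halts \<rho> (Num (Suc n)) (Alg s))"
      by (metis gr0_conv_Suc not_gr_zero zero_less_Suc)
    then show ?thesis using 1 2 by (auto simp: rules_of_def)
  qed
  ultimately show ?thesis by blast
qed

text \<open>A library has at least one rule, so for a finite base the induction starts from the
  constant library of \<open>r\<close>. An infinite base is already the set of terms of a
  library.\<close>

lemma exists_library_base_insert:
  assumes r: "is_rule r" and \<B>: "base \<B>"
  shows "\<exists>\<rho>. library \<rho> \<and> rules_of \<rho> = insert r \<B>"
proof (cases "finite \<B>")
  case True
  from this \<B> have "finite \<B>" "\<forall>s\<in>\<B>. is_rule s" by (auto simp: base_def)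
  then show ?thesis
  proof (induction \<B> rule: finite_induct)
    case empty
    have "library (Const (Alg r))" "rules_of (Const (Alg r)) = {r}"
      using r by (auto simp: library_def rules_of_def halts_Const)
    then show ?case by blast
  next
    case (insert s \<B>)
    then show ?case using exists_library_insert[of s] by (metis insertCI insert_commute)
  qed
next
  case False
  with \<B> obtain \<sigma> where "library \<sigma>" "\<B> = rules_of \<sigma>" by (auto simp: base_def)
  then show ?thesis using exists_library_insert[OF r] by blast
qed

section \<open>The self-referential statement and its rule\<close>

text \<open>Self-reference comes from passing \<open>q\<close> to itself as part of its input, in
  place of a recursion theorem. Output 1 reports a verified \<open>\<not>Q\<close> and output 0 a
  verified \<open>\<not>\<not>Q\<close>, where \<open>Q\<close> claims output 1.\<close>

lemma exists_diagonal_stmt: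
  obtains q where
    "\<And>\<rho> v. halts q (Lst [Alg q, \<rho>]) v \<Longrightarrow>
       v = Num 0 \<and> true_stmt (neg deduce \<rho> (neg deduce \<rho> (stmt q (Lst [Alg q, \<rho>]) (Num 1)))) \<or>
       v = Num 1 \<and> true_stmt (neg deduce \<rho> (stmt q (Lst [Alg q, \<rho>]) (Num 1)))"
    "\<And>\<rho>. true_stmt (neg deduce \<rho> (stmt q (Lst [Alg q, \<rho>]) (Num 1))) \<or>
       true_stmt (neg deduce \<rho> (neg deduce \<rho> (stmt q (Lst [Alg q, \<rho>]) (Num 1)))) \<Longrightarrow>
       \<exists>v. halts q (Lst [Alg q, \<rho>]) v"
proof -
  let ?h = "prim_fun Head" and ?t = "prim_fun Tail"
  obtain race where race:
    "\<And>A B v. A \<in> Stmts \<Longrightarrow> B \<in> Stmts \<Longrightarrow> halts race (Lst [A, B]) v \<Longrightarrow>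
       v = Num 0 \<and> true_stmt B \<or> v = Num 1 \<and> true_stmt A"
    "\<And>A B. A \<in> Stmts \<Longrightarrow> B \<in> Stmts \<Longrightarrow> true_stmt A \<or> true_stmt B \<Longrightarrow>
       \<exists>v. halts race (Lst [A, B]) v"
    using exists_race by blast
  \<comment> \<open>On \<open>w = [x, \<rho>]\<close> this is the statement that \<open>x\<close>
    outputs 1 on \<open>[x, \<rho>]\<close>; putting \<open>q\<close> for \<open>x\<close> closes
    the loop.\<close>
  define Q where "Q w = Lst [?h w, Lst [?h w, ?h (?t w)], Num 1]" for w
  define N where "N A w = neg deduce (?h (?t w)) A" for A w
  have cQ: "computable Q" unfolding Q_def by (intro computable_intros)
  have cN: "computable (\<lambda>w. N (A w) w)" if "computable A" for A
    unfolding N_def neg_def implies_def entails_def stmt_def by (intro computable_intros that)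
  have "computable (\<lambda>w. Lst [N (Q w) w, N (N (Q w) w) w])"
    by (intro computable_intros cN cQ)
  then obtain p where p: "\<And>w v. halts p w v \<longleftrightarrow> v = Lst [N (Q w) w, N (N (Q w) w) w]"
    by (rule computable_alg) blast
  define q where "q = Comp race p"
  define A where "A \<rho> = neg deduce \<rho> (stmt q (Lst [Alg q, \<rho>]) (Num 1))" for \<rho>
  have q: "halts q (Lst [Alg q, \<rho>]) v \<longleftrightarrow> halts race (Lst [A \<rho>, neg deduce \<rho> (A \<rho>)]) v" for \<rho> v
  proof -
    have "halts p (Lst [Alg q, \<rho>]) v \<longleftrightarrow> v = Lst [A \<rho>, neg deduce \<rho> (A \<rho>)]" for v
      unfolding p by (simp add: N_def Q_def A_def stmt_def)
    then show ?thesis by (subst q_def) (simp add: halts_Comp)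
  qed
  show ?thesis
    using that[of q, folded A_def] race q neg_in_Stmts A_def by metis
qed

text \<open>The resource integer serves as time bound for \<open>q\<close>, so the side condition is
  decidable and the rule always halts. The condition persists under more time and more hypotheses,
  which gives monotonicity.\<close>

lemma exists_diagonal_rule:
  obtains r where "is_rule r"
    "\<And>H \<rho> m. halts r (rule_input H \<rho> m)
       (Lst (H @ (if sim (Lst [Alg q, Lst [Alg q, Alg \<rho>], Num m]) = Lst [Num 0] \<and>
                     stmt q (Lst [Alg q, Alg \<rho>]) (Num 1) \<in> set H then [falsum] else [])))"
proof -
  let ?h = "prim_fun Head" and ?t = "prim_fun Tail"
  \<comment> \<open>The second item of a rule input is the nominal library; \<open>u\<close> pairs
    it with \<open>q\<close>.\<close>
  define u where "u w = Lst [Alg q, ?h (?t w)]" for w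
  define C where "C w \<longleftrightarrow> sim (Lst [Alg q, u w, ?h (?t (?t w))]) = Lst [Num 0] \<and>
    Lst [Alg q, u w, Num 1] \<in> set (items (?h w))" for w
  have cu: "computable u" unfolding u_def by (intro computable_intros)
  have "decidable C"
    unfolding C_def by (intro computable_intros computable_sim decidable_member cu)
  then have "computable (\<lambda>w. Lst (items (?h w) @ items (if C w then Lst [falsum] else Lst [])))"
    by (intro computable_append computable_intros)
  then obtain r where "\<And>w v. halts r w v \<longleftrightarrow>
      v = Lst (items (?h w) @ items (if C w then Lst [falsum] else Lst []))"
    by (rule computable_alg) blast
  moreover define c where "c H \<rho> m \<longleftrightarrow> sim (Lst [Alg q, Lst [Alg q, Alg \<rho>], Num m]) = Lst [Num 0] \<and>
    stmt q (Lst [Alg q, Alg \<rho>]) (Num 1) \<in> set H" for H \<rho> m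
  ultimately have r: "halts r (rule_input H \<rho> m) v \<longleftrightarrow>
      v = Lst (H @ (if c H \<rho> m then [falsum] else []))" for H \<rho> m v
    by (simp add: rule_input_def C_def u_def stmt_def)
  have mono: "c H' \<rho> m'" if "c H \<rho> m" "set H \<subseteq> set H'" "m \<le> m'" for H H' \<rho> m m'
    using that sim_mono unfolding c_def by blast
  have "is_rule r"
    unfolding is_rule_def r using mono by auto
  then show ?thesis using that[of r] r unfolding c_def by blast
qed

section \<open>Failure of excluded middle and its weak form over a stable base\<close>

lemma not_rule_valid_premise_free:
  assumes r: "implements_premise_free Y r" and \<rho>: "library \<rho>" and A: "A \<in> Stmts"
    and false: "\<not> true_stmt (Y (Alg \<rho>) A)"
  shows "\<not> rule_valid \<rho> r"
proof
  assume valid: "rule_valid \<rho> r"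
  \<comment> \<open>With this resource the false instance is among those appended, even to the empty
    hypothesis list.\<close>
  let ?m = "dsize (Y (Alg \<rho>) A)"
  have m: "?m > 0" by (rule dsize_pos)
  have "set [] \<subseteq> Stmts" by simp
  then obtain K where K: "halts r (rule_input [] \<rho> ?m) (Lst ([] @ K))"
    "set K = {Y (Alg \<rho>) A' |A'. A' \<in> Stmts \<and> dsize (Y (Alg \<rho>) A') \<le> ?m}"
    using r m algorithmic_sequence_library[OF \<rho>] unfolding implements_premise_free_def by blast
  have "Y (Alg \<rho>) A \<in> set K" using A K(2) by blast
  moreover have "\<forall>A\<in>set ([] @ K). true_stmt A"
    using valid K(1) m unfolding rule_valid_def by (metis empty_iff empty_set)
  ultimately show False using false by simp
qed

lemma stable_base_undecided_stmt:
  assumes f: "recursive_bijection f" and d: "implements_deduce f deduce"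
    and \<B>: "stable_base \<B>"
  obtains \<rho> Q where "base_library \<B> \<rho>" "valid_library \<rho>" "Q \<in> Stmts" "\<not> true_stmt Q"
    "\<not> true_stmt (neg deduce (Alg \<rho>) Q)"
    "\<not> true_stmt (neg deduce (Alg \<rho>) (neg deduce (Alg \<rho>) Q))"
proof -
  obtain q where q:
    "\<And>\<rho> v. halts q (Lst [Alg q, \<rho>]) v \<Longrightarrow>
       v = Num 0 \<and> true_stmt (neg deduce \<rho> (neg deduce \<rho> (stmt q (Lst [Alg q, \<rho>]) (Num 1)))) \<or>
       v = Num 1 \<and> true_stmt (neg deduce \<rho> (stmt q (Lst [Alg q, \<rho>]) (Num 1)))"
    "\<And>\<rho>. true_stmt (neg deduce \<rho> (stmt q (Lst [Alg q, \<rho>]) (Num 1))) \<or>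
       true_stmt (neg deduce \<rho> (neg deduce \<rho> (stmt q (Lst [Alg q, \<rho>]) (Num 1)))) \<Longrightarrow>
       \<exists>v. halts q (Lst [Alg q, \<rho>]) v"
    using exists_diagonal_stmt[of deduce] by blast
  obtain r where r: "is_rule r" "\<And>H \<rho> m. halts r (rule_input H \<rho> m)
       (Lst (H @ (if sim (Lst [Alg q, Lst [Alg q, Alg \<rho>], Num m]) = Lst [Num 0] \<and>
                     stmt q (Lst [Alg q, Alg \<rho>]) (Num 1) \<in> set H then [falsum] else [])))"
    using exists_diagonal_rule[of q] by blast
  from \<B> have "base \<B>" by (simp add: stable_base_def)
  with r(1) obtain \<rho> where lib: "library \<rho>" and rules: "rules_of \<rho> = insert r \<B>"
    using exists_library_base_insert by blast
  define u where "u = Lst [Alg q, Alg \<rho>]"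
  define Q where "Q = stmt q u (Num 1)"
  define N where "N = neg deduce (Alg \<rho>) Q"
  note q = q[of "Alg \<rho>", folded u_def, folded Q_def, folded N_def]
  note r_out = r(2)[of _ \<rho>, folded u_def, folded Q_def]
  have "rule_valid \<rho> r"
    unfolding rule_valid_def
  proof (intro allI impI, elim conjE)
    fix H m L assume H: "\<forall>A\<in>set H. true_stmt A" and L: "halts r (rule_input H \<rho> m) (Lst L)"
    have "\<not> (sim (Lst [Alg q, u, Num m]) = Lst [Num 0] \<and> Q \<in> set H)"
    proof
      assume "sim (Lst [Alg q, u, Num m]) = Lst [Num 0] \<and> Q \<in> set H"
      then have "halts q u (Num 0)" "halts q u (Num 1)"
        using H by (auto simp: halts_iff_sim[of q] Q_def)
      then show False using halts_unique by fastforce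
    qed
    then have "halts r (rule_input H \<rho> m) (Lst H)" using r_out[of H m] by auto
    with L have "L = H" using halts_unique by blast
    with H show "\<forall>A\<in>set L. true_stmt A" by simp
  qed
  \<comment> \<open>At most \<open>r\<close> lies outside the base, so its validity is all that
    stability asks for.\<close>
  then have "base_library \<B> \<rho> \<and> valid_outside \<B> \<rho>"
    using lib rules by (auto simp: base_library_def valid_outside_def)
  with \<B> have base_lib: "base_library \<B> \<rho>" and valid: "valid_library \<rho>"
    by (auto simp: stable_base_def)
  have "\<not> halts q u v" for v
  proof
    assume v: "halts q u v"
    from q(1)[OF v] show False
    proof
      assume 0: "v = Num 0 \<and> true_stmt (neg deduce (Alg \<rho>) N)"
      with v obtain t where "sim (Lst [Alg q, u, Num t]) = Lst [Num 0]"
        by (auto simp: halts_iff_sim)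
      \<comment> \<open>Resource integers are positive, so the time bound is raised to
        \<open>Suc t\<close>.\<close>
      then have t: "sim (Lst [Alg q, u, Num (Suc t)]) = Lst [Num 0]"
        by (rule sim_mono) simp
      have "true_stmt N"
        unfolding N_def
      proof (rule true_neg_rule[OF f d lib])
        show "\<exists>L. halts r (rule_input H \<rho> (Suc t)) (Lst L) \<and> falsum \<in> set L" if "Q \<in> set H" for H
          using r_out[of H "Suc t"] t that by auto
      qed (simp_all add: rules Q_def)
      with 0 show False using neg_sound[OF f d valid] by blast
    next
      assume "v = Num 1 \<and> true_stmt N"
      then show False using v neg_sound[OF f d valid, of Q] by (auto simp: Q_def N_def)
    qed
  qed
  \<comment> \<open>\<open>Q\<close> asserts that \<open>q\<close> halts, and by \<open>q(2)\<close>
    the truth of either negation would make it halt.\<close>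
  then have "\<not> true_stmt Q" "\<not> true_stmt N" "\<not> true_stmt (neg deduce (Alg \<rho>) N)"
    using q(2) by (auto simp: Q_def)
  then show ?thesis
    using that[OF base_lib valid, of Q] stmt_in_Stmts unfolding N_def Q_def by blast
qed

theorem corollary14p10:
  fixes f :: "nat \<Rightarrow> nat \<times> nat" and deduce or_alg :: alg
  assumes "recursive_bijection f"
    and "implements_deduce f deduce"
    and "implements_or or_alg"
  shows "(\<forall>\<B>. stable_base \<B> \<longrightarrow>
            (\<exists>\<rho> Q. base_library \<B> \<rho> \<and> valid_library \<rho> \<and> Q \<in> Stmts \<and>
               false_stmt (disj or_alg Q (neg deduce (Alg \<rho>) Q)) \<and>
               false_stmt (disj or_alg (neg deduce (Alg \<rho>) Q)
                             (neg deduce (Alg \<rho>) (neg deduce (Alg \<rho>) Q))) \<and>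
               (\<forall>r. implements_P8 deduce or_alg r \<longrightarrow> \<not> rule_valid \<rho> r) \<and>
               (\<forall>r. implements_P9 deduce or_alg r \<longrightarrow> \<not> rule_valid \<rho> r))) \<and>
         (\<nexists>\<B>. stable_base \<B> \<and>
            (\<exists>r\<in>\<B>. implements_P8 deduce or_alg r \<or> implements_P9 deduce or_alg r))"
proof -
  have main: "\<exists>\<rho> Q. base_library \<B> \<rho> \<and> valid_library \<rho> \<and> Q \<in> Stmts \<and>
      false_stmt (disj or_alg Q (neg deduce (Alg \<rho>) Q)) \<and>
      false_stmt (disj or_alg (neg deduce (Alg \<rho>) Q)
        (neg deduce (Alg \<rho>) (neg deduce (Alg \<rho>) Q))) \<and>
      (\<forall>r. implements_P8 deduce or_alg r \<longrightarrow> \<not> rule_valid \<rho> r) \<and>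
      (\<forall>r. implements_P9 deduce or_alg r \<longrightarrow> \<not> rule_valid \<rho> r)"
    if stable: "stable_base \<B>" for \<B>
  proof -
    obtain \<rho> Q where \<rho>: "base_library \<B> \<rho>" "valid_library \<rho>" and Q: "Q \<in> Stmts"
      and false: "\<not> true_stmt Q" "\<not> true_stmt (neg deduce (Alg \<rho>) Q)"
        "\<not> true_stmt (neg deduce (Alg \<rho>) (neg deduce (Alg \<rho>) Q))"
      using stable_base_undecided_stmt[OF assms(1,2) stable] by blast
    have lib: "library \<rho>" using \<rho>(2) by (simp add: valid_library_def)
    have 8: "\<not> true_stmt (disj or_alg Q (neg deduce (Alg \<rho>) Q))"
      and 9: "\<not> true_stmt (disj or_alg (neg deduce (Alg \<rho>) Q)
        (neg deduce (Alg \<rho>) (neg deduce (Alg \<rho>) Q)))"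
      using true_disj_iff[OF assms(3)] Q false by simp_all
    have "\<forall>r. implements_P8 deduce or_alg r \<longrightarrow> \<not> rule_valid \<rho> r"
      unfolding implements_P8_def using not_rule_valid_premise_free[OF _ lib Q] 8 by blast
    moreover have "\<forall>r. implements_P9 deduce or_alg r \<longrightarrow> \<not> rule_valid \<rho> r"
      unfolding implements_P9_def using not_rule_valid_premise_free[OF _ lib Q] 9 by blast
    ultimately show ?thesis
      using \<rho> Q 8 9 by (auto simp: false_stmt_def disj_def)
  qed
  \<comment> \<open>The library supplied by \<open>main\<close> is valid and contains the base, so
    \<open>r\<close> would have to be valid for it.\<close>
  moreover have False
    if "stable_base \<B>" "r \<in> \<B>" "implements_P8 deduce or_alg r \<or> implements_P9 deduce or_alg r"
    for \<B> r
    using main[OF that(1)] that(2,3) unfolding base_library_def valid_library_def by blast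
  ultimately show ?thesis by blast
qed

end
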